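(* Let $k>1$ be an odd integer. Then for all integers $n\ge 0$: \begin{align*} p_{-(3^{k}-6b)/b}\left(3^{k} n+\frac{3^{k+1}-1}{4}\right)&\equiv 0 \pmod{3^{k}},\\ p_{-(5^{k}-8b)/b}\left(5^{k} n+\frac{2\cdot 5^{k}-1}{3}\right)&\equiv 0 \pmod{5^{k}},\\ p_{-(5^{k}-14b)/b}\left(5^{k} n+\frac{11\cdot 5^{k}-7}{12}\right)&\equiv 0 \pmod{5^{k}},\\ p_{-(7^{k}-6b)/b}\left(7^{k} n+\frac{3\cdot 7^{k}-1}{4}\right)&\equiv 0 \pmod{7^{k}}, \end{align*} where in each congruence $b$ is any positive integer coprime to the modulus (i.e. to $3$, $5$, $5$, $7$ respectively).
   Context: For a rational number $t\neq 0$, the rational numbers $p_t(n)$, $n\ge 0$, are defined by the formal power series identity $\sum_{n\ge 0}p_t(n)q^n=\prod_{j\ge 1}(1-q^j)^t$, where each factor $(1-q^j)^t$ is the binomial series with constant term $1$. For a prime $\ell$ not dividing the denominator of $t$, a congruence $p_t(N)\equiv 0\pmod{\ell^k}$ means that the numerator of $p_t(N)$, written as a reduced fraction, is divisible by $\ell^k$ (the denominator of $p_t(N)$ is then coprime to $\ell$). *)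

theory Defs
  imports
    "HOL-Analysis.Infinite_Products"
    "HOL-Computational_Algebra.Formal_Power_Series"
begin

text \<open>
  The binomial series $(1 - q^j)^t = \sum_i \binom{t}{i} (-1)^i q^{ij}$. It is only meaningful for
  \<open>j > 0\<close>, as \<open>oo\<close> is a composition of power series only if the inner one has constant term 0.
\<close>
definition one_minus_q_powr :: "nat \<Rightarrow> rat \<Rightarrow> rat fps" where
  "one_minus_q_powr j t = fps_binomial t oo (- (fps_X ^ j))"

text \<open>
  The product is taken with respect to the $q$-adic topology on \<^typ>\<open>rat fps\<close>; its convergence
  is shown in \<open>has_prod_one_minus_q_powr\<close> below. Since \<^const>\<open>prodinf\<close> indexes from 0, the factors
  with \<open>j \<ge> 1\<close> appear as \<open>Suc i\<close>.
\<close>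
definition p_frac :: "rat \<Rightarrow> nat \<Rightarrow> rat" where
  "p_frac t n = fps_nth (\<Prod>i. one_minus_q_powr (Suc i) t) n"

lemma one_minus_q_powr_nth:
  assumes "j > 0"
  shows "fps_nth (one_minus_q_powr j t) n =
           (if j dvd n then (t gchoose (n div j)) * (-1) ^ (n div j) else 0)"
proof -
  have pow: "(- (fps_X ^ j) :: rat fps) ^ i = fps_const ((-1) ^ i) * fps_X ^ (j * i)" for i
  proof -
    have "(- (fps_X ^ j) :: rat fps) ^ i = (-1) ^ i * (fps_X ^ j) ^ i"
      by (rule power_minus)
    also have "(-1 :: rat fps) ^ i = fps_const ((-1) ^ i)"
      by (metis fps_const_1_eq_1 fps_const_neg fps_const_power)
    finally show ?thesis
      by (simp add: power_mult)
  qed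
  have "fps_nth (one_minus_q_powr j t) n =
          (\<Sum>i=0..n. if n = j * i then (t gchoose i) * (-1) ^ i else 0)"
    unfolding one_minus_q_powr_def fps_compose_nth
    by (intro sum.cong refl) (simp add: pow fps_X_power_nth)
  also have "\<dots> = (if j dvd n then (t gchoose (n div j)) * (-1) ^ (n div j) else 0)"
  proof (cases "j dvd n")
    case True
    have *: "n = j * i \<longleftrightarrow> i = n div j" for i
      using True assms by auto
    show ?thesis
      using True by (simp add: *)
  next
    case False
    then have "n \<noteq> j * i" for i by auto
    with False show ?thesis by simp
  qed
  finally show ?thesis .
qed

lemma prod_one_minus_q_powr_nth_stable:
  assumes "n \<le> N"
  shows "fps_nth (\<Prod>i\<le>N. one_minus_q_powr (Suc i) t) n =
         fps_nth (\<Prod>i\<le>n. one_minus_q_powr (Suc i) t) n"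
  using assms
proof (induction N rule: dec_induct)
  case base
  show ?case ..
next
  case (step N)
  let ?P = "\<Prod>i\<le>N. one_minus_q_powr (Suc i) t"
  have fac: "fps_nth (one_minus_q_powr (Suc (Suc N)) t) m = (if m = 0 then 1 else 0)"
    if "m \<le> n" for m
    using that step.hyps by (auto simp: one_minus_q_powr_nth dest: dvd_imp_le)
  have "fps_nth (\<Prod>i\<le>Suc N. one_minus_q_powr (Suc i) t) n =
          (\<Sum>m=0..n. fps_nth ?P m * fps_nth (one_minus_q_powr (Suc (Suc N)) t) (n - m))"
    by (simp add: fps_mult_nth)
  also have "\<dots> = (\<Sum>m=0..n. if m = n then fps_nth ?P m else 0)"
    by (intro sum.cong refl) (auto simp: fac)
  also have "\<dots> = fps_nth ?P n"
    by simp
  finally show ?case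
    using step.IH by simp
qed

lemma has_prod_one_minus_q_powr:
  "(\<lambda>i. one_minus_q_powr (Suc i) t) has_prod
     Abs_fps (\<lambda>n. fps_nth (\<Prod>i\<le>n. one_minus_q_powr (Suc i) t) n)"
proof -
  let ?P = "Abs_fps (\<lambda>n. fps_nth (\<Prod>i\<le>n. one_minus_q_powr (Suc i) t) n)"
  have "(\<lambda>N. \<Prod>i\<le>N. one_minus_q_powr (Suc i) t) \<longlonglongrightarrow> ?P"
  proof (rule tendsto_fpsI)
    fix n
    show "\<forall>\<^sub>F N in sequentially.
            fps_nth (\<Prod>i\<le>N. one_minus_q_powr (Suc i) t) n = fps_nth ?P n"
      using eventually_ge_at_top[of n]
      by eventually_elim (simp, rule prod_one_minus_q_powr_nth_stable)
  qed
  moreover have "fps_nth ?P 0 = 1"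
    by (simp add: one_minus_q_powr_nth)
  then have "?P \<noteq> 0"
    by (metis fps_zero_nth zero_neq_one)
  ultimately show ?thesis
    unfolding has_prod_def raw_has_prod_def by simp
qed

lemma p_frac_eq_finite_prod:
  assumes "n \<le> N"
  shows "p_frac t n = fps_nth (\<Prod>i\<le>N. one_minus_q_powr (Suc i) t) n"
  unfolding p_frac_def
  by (subst has_prod_unique[OF has_prod_one_minus_q_powr, symmetric])
     (simp add: prod_one_minus_q_powr_nth_stable[OF assms])

text \<open>The divisions in the arguments of \<^const>\<open>p_frac\<close> considered later are exact for odd \<open>k\<close>.\<close>

lemma index_divisions_exact:
  fixes k :: nat
  assumes "odd k"
  shows "4 dvd (3 ^ (k + 1) - 1 :: nat)" "3 dvd (2 * 5 ^ k - 1 :: nat)"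
    "12 dvd (11 * 5 ^ k - 7 :: nat)" "4 dvd (3 * 7 ^ k - 1 :: nat)"
proof -
  obtain m where k: "k = 2 * m + 1"
    using assms by (elim oddE)
  have a: "(9::nat) ^ m mod 4 = 1"
    by (subst power_mod [symmetric]) simp
  have b: "(25::nat) ^ m mod 12 = 1"
    by (subst power_mod [symmetric]) simp
  have c: "(49::nat) ^ m mod 4 = 1"
    by (subst power_mod [symmetric]) simp
  have pow: "(3::nat) ^ (k + 1) = 9 * 9 ^ m" "(5::nat) ^ k = 5 * 25 ^ m" "(7::nat) ^ k = 7 * 49 ^ m"
    by (simp_all add: k power_mult)
  obtain x where x: "(9::nat) ^ m = 4 * x + 1"
    using a by (metis mult_div_mod_eq)
  obtain y where y: "(25::nat) ^ m = 12 * y + 1"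
    using b by (metis mult_div_mod_eq)
  obtain z where z: "(49::nat) ^ m = 4 * z + 1"
    using c by (metis mult_div_mod_eq)
  show "4 dvd (3 ^ (k + 1) - 1 :: nat)"
    by (rule dvdI[of _ _ "9 * x + 2"]) (simp only: pow x, simp)
  show "3 dvd (2 * 5 ^ k - 1 :: nat)"
    by (rule dvdI[of _ _ "40 * y + 3"]) (simp add: pow y)
  show "12 dvd (11 * 5 ^ k - 7 :: nat)"
    by (rule dvdI[of _ _ "55 * y + 4"]) (simp add: pow y)
  show "4 dvd (3 * 7 ^ k - 1 :: nat)"
    by (rule dvdI[of _ _ "21 * z + 5"]) (simp add: pow z)
qed

end

theory Submission
  imports Defs "HOL-Computational_Algebra.Computational_Algebra"
begin

text \<open>
  Write $E = \prod_{j \ge 1} (1 - q^j)$. The coefficient $p_t(N)$ is $\ell$-adically continuous in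
  $t$, so the exponent $t = d - \ell^k / b$ may be replaced by a natural number $d + \ell^k r$ with
  $r b \equiv -1$ modulo a high power of $\ell$. As $E^{\ell^k r}$ is an $\ell^k$-th power, it
  suffices that $\ell^j$ divides the $N$-th coefficient of $E^d$ whenever $\ell^j$ divides $24 N + d$
  (divided by $\gcd(24, d)$).

  For $d = 6$ this follows from Jacobi's $E^3 = \sum_i (-1)^i (2i + 1) q^{i(i+1)/2}$: the coefficients
  of $E^6$ are sums of products $x y$ with $x^2 + y^2 = 2 (4N + 1)$, and $\ell = 3, 7$ divide a sum
  of two squares only if they divide both terms.
  For $d = 8, 14$ and $\ell = 5$, let $E = A + B + C$ be the dissection by exponents modulo 5. Then
  $B = -q E(q^{25})$ by the pentagonal number theorem and $A C = -B^2$, so that the relevant residue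
  class of $A^d E^d = (A^2 + A B - B^2)^d$ consists of the single term $c A^d B^d$ with
  $c = -5^3$ or $c = -5^6$.
\<close>

section \<open>Divisibility in the localization at a prime\<close>

text \<open>For prime \<open>l\<close> this is membership of \<open>x\<close> in l^k Z_(l). Clearing
  the denominator with a factor coprime to \<open>l\<close> avoids a valuation on the rationals and
  a special value for \<open>x = 0\<close>.\<close>

definition padic_dvd :: "int \<Rightarrow> nat \<Rightarrow> rat \<Rightarrow> bool" where
  "padic_dvd l k x \<longleftrightarrow> (\<exists>c a. coprime l c \<and> of_int c * x = of_int (l ^ k * a))"

lemma padic_dvdI: "coprime l c \<Longrightarrow> of_int c * x = of_int (l ^ k * a) \<Longrightarrow> padic_dvd l k x"
  unfolding padic_dvd_def by blast

lemma padic_dvd_add: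
  assumes "padic_dvd l k x" "padic_dvd l k y"
  shows "padic_dvd l k (x + y)"
proof -
  obtain c a where c: "coprime l c" "of_int c * x = of_int (l ^ k * a)"
    using assms(1) by (auto simp: padic_dvd_def)
  obtain d b where d: "coprime l d" "of_int d * y = of_int (l ^ k * b)"
    using assms(2) by (auto simp: padic_dvd_def)
  have "of_int (c * d) * (x + y) = of_int d * (of_int c * x) + of_int c * (of_int d * y)"
    by (simp add: algebra_simps)
  also have "\<dots> = of_int (l ^ k * (d * a + c * b))"
    unfolding c d by (simp add: algebra_simps)
  finally show ?thesis
    by (rule padic_dvdI[rotated]) (use c(1) d(1) in simp)
qed

lemma padic_dvd_mult:
  assumes "padic_dvd l j x" "padic_dvd l k y"
  shows "padic_dvd l (j + k) (x * y)"
proof -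
  obtain c a where c: "coprime l c" "of_int c * x = of_int (l ^ j * a)"
    using assms(1) by (auto simp: padic_dvd_def)
  obtain d b where d: "coprime l d" "of_int d * y = of_int (l ^ k * b)"
    using assms(2) by (auto simp: padic_dvd_def)
  have "of_int (c * d) * (x * y) = (of_int c * x) * (of_int d * y)"
    by (simp add: algebra_simps)
  also have "\<dots> = of_int (l ^ (j + k) * (a * b))"
    unfolding c d by (simp add: algebra_simps power_add)
  finally show ?thesis
    by (rule padic_dvdI[rotated]) (use c(1) d(1) in simp)
qed

lemma padic_dvd_mono:
  assumes "padic_dvd l k x" "j \<le> k"
  shows "padic_dvd l j x"
proof -
  obtain c a where c: "coprime l c" "of_int c * x = of_int (l ^ k * a)"
    using assms(1) by (auto simp: padic_dvd_def)
  have "l ^ k * a = l ^ j * (l ^ (k - j) * a)"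
    using assms(2) by (simp flip: mult.assoc power_add)
  with c show ?thesis by (metis padic_dvdI)
qed

lemma padic_dvd_of_int: "l ^ k dvd a \<Longrightarrow> padic_dvd l k (of_int a)"
  by (auto elim!: dvdE intro: padic_dvdI[of l 1])

lemma padic_dvd_uminus: "padic_dvd l k x \<Longrightarrow> padic_dvd l k (- x)"
  using padic_dvd_mult[of l k x 0 "-1"] padic_dvd_of_int[of l 0 "-1"] by simp

text \<open>Multiplication by a fixed rational loses only a bounded power of \<open>l\<close>,
  namely the \<open>l\<close>-part of its denominator. This is what makes products of continuous
  functions continuous although their values need not be \<open>l\<close>-integral.\<close>

lemma ex_padic_dvd_mult:
  assumes "prime l"
  shows "\<exists>M. \<forall>x. padic_dvd l M x \<longrightarrow> padic_dvd l K (r * x)"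
proof -
  obtain a b where r: "r = of_int a / of_int b" and b: "b > 0"
    by (metis quotient_of_denom_pos quotient_of_div surj_pair)
  obtain s where s: "b = l ^ multiplicity l b * s" and "\<not> l dvd s"
  proof (rule multiplicity_decompose'[of b l])
    show "b \<noteq> 0" "\<not> is_unit l" using b assms by auto
  qed
  then have cop: "coprime l s"
    using assms prime_imp_coprime by blast
  show ?thesis
  proof (intro exI allI impI)
    fix x assume "padic_dvd l (K + multiplicity l b) x"
    then obtain c d where c: "coprime l c" "of_int c * x = of_int (l ^ (K + multiplicity l b) * d)"
      by (auto simp: padic_dvd_def)
    define L :: rat where "L = of_int (l ^ multiplicity l b)"
    have L: "L \<noteq> 0" using assms by (auto simp: L_def prime_gt_0_int)
    have bs: "of_int b = L * of_int s"
      using arg_cong[OF s, of "of_int :: int \<Rightarrow> rat"] unfolding L_def by (simp only: of_int_mult)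
    have s0: "(of_int s :: rat) \<noteq> 0" using b s by auto
    have "of_int (c * s) * (r * x) = of_int s * of_int a / of_int b * (of_int c * x)"
      by (simp add: r)
    also have "\<dots> = of_int (l ^ K * (a * d))"
      unfolding c bs using L s0 by (simp add: power_add L_def field_simps)
    finally show "padic_dvd l K (r * x)"
      by (rule padic_dvdI[rotated]) (use c(1) cop in simp)
  qed
qed

text \<open>The way back to reduced fractions: with x = u/v one gets c * u = l^k * a * v, and
  \<open>c\<close> is coprime to \<open>l\<close>.\<close>

lemma padic_dvd_imp_dvd_numerator:
  assumes "padic_dvd l k x"
  shows "l ^ k dvd fst (quotient_of x)"
proof -
  obtain c a where c: "coprime l c" "of_int c * x = of_int (l ^ k * a)"
    using assms by (auto simp: padic_dvd_def)
  obtain u v where uv: "quotient_of x = (u, v)" by fastforce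
  have v: "v > 0" "x = of_int u / of_int v"
    using quotient_of_denom_pos[OF uv] quotient_of_div[OF uv] by auto
  have "of_int (c * u) = (of_int (l ^ k * a * v) :: rat)"
    using c(2) v by (simp add: field_simps)
  then have "c * u = l ^ k * a * v" by (simp only: of_int_eq_iff)
  then have "l ^ k dvd c * u" by simp
  then show ?thesis
    using c(1) by (simp add: uv coprime_dvd_mult_right_iff)
qed

section \<open>Continuity of p_t(n) in t for the l-adic topology\<close>

definition padic_cont :: "int \<Rightarrow> rat \<Rightarrow> (rat \<Rightarrow> rat) \<Rightarrow> bool" where
  "padic_cont l t f \<longleftrightarrow> (\<forall>K. \<exists>M. \<forall>y. padic_dvd l M (y - t) \<longrightarrow> padic_dvd l K (f y - f t))"

lemma padic_cont_const: "padic_cont l t (\<lambda>_. c)"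
  using padic_dvd_of_int[of l _ 0] by (auto simp: padic_cont_def)

lemma padic_cont_ident: "padic_cont l t (\<lambda>x. x)"
  by (auto simp: padic_cont_def)

lemma padic_cont_add:
  assumes "padic_cont l t f" "padic_cont l t g"
  shows "padic_cont l t (\<lambda>x. f x + g x)"
  unfolding padic_cont_def
proof
  fix K
  obtain M N where M: "\<And>y. padic_dvd l M (y - t) \<Longrightarrow> padic_dvd l K (f y - f t)"
    and N: "\<And>y. padic_dvd l N (y - t) \<Longrightarrow> padic_dvd l K (g y - g t)"
    using assms unfolding padic_cont_def by meson
  show "\<exists>M. \<forall>y. padic_dvd l M (y - t) \<longrightarrow> padic_dvd l K (f y + g y - (f t + g t))"
  proof (intro exI allI impI)
    fix y assume y: "padic_dvd l (max M N) (y - t)"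
    have "padic_dvd l K ((f y - f t) + (g y - g t))"
      by (intro padic_dvd_add M N padic_dvd_mono[OF y]) auto
    then show "padic_dvd l K (f y + g y - (f t + g t))" by (simp add: algebra_simps)
  qed
qed

lemma padic_cont_mult:
  assumes "prime l" "padic_cont l t f" "padic_cont l t g"
  shows "padic_cont l t (\<lambda>x. f x * g x)"
  unfolding padic_cont_def
proof
  fix K
  \<comment> \<open>\<open>A\<close> and \<open>B\<close> compensate for powers of \<open>l\<close>
    in the denominators of \<open>g t\<close> and \<open>f t\<close>.\<close>
  obtain A where A: "\<And>x. padic_dvd l A x \<Longrightarrow> padic_dvd l K (g t * x)"
    using ex_padic_dvd_mult[OF assms(1)] by meson
  obtain B where B: "\<And>x. padic_dvd l B x \<Longrightarrow> padic_dvd l K (f t * x)"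
    using ex_padic_dvd_mult[OF assms(1)] by meson
  obtain M where M: "\<And>y. padic_dvd l M (y - t) \<Longrightarrow> padic_dvd l A (f y - f t)"
    using assms(2) unfolding padic_cont_def by meson
  obtain N where N: "\<And>y. padic_dvd l N (y - t) \<Longrightarrow> padic_dvd l (max B K) (g y - g t)"
    using assms(3) unfolding padic_cont_def by meson
  show "\<exists>M. \<forall>y. padic_dvd l M (y - t) \<longrightarrow> padic_dvd l K (f y * g y - f t * g t)"
  proof (intro exI allI impI)
    fix y assume y: "padic_dvd l (max M N) (y - t)"
    have f: "padic_dvd l A (f y - f t)" by (intro M padic_dvd_mono[OF y]) auto
    have g: "padic_dvd l (max B K) (g y - g t)" by (intro N padic_dvd_mono[OF y]) auto
    \<comment> \<open>The product of the two increments needs only one small factor; the other one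
      is merely used as \<open>l\<close>-integral (exponent 0).\<close>
    have "padic_dvd l K (g t * (f y - f t) + f t * (g y - g t) + (f y - f t) * (g y - g t))"
      using padic_dvd_mult[OF padic_dvd_mono[OF f, of 0] padic_dvd_mono[OF g, of K]]
      by (intro padic_dvd_add A B padic_dvd_mono[OF f] padic_dvd_mono[OF g]) auto
    then show "padic_dvd l K (f y * g y - f t * g t)" by (simp add: algebra_simps)
  qed
qed

lemma padic_cont_sum:
  "(\<And>i. i \<in> A \<Longrightarrow> padic_cont l t (f i)) \<Longrightarrow> padic_cont l t (\<lambda>x. \<Sum>i\<in>A. f i x)"
  by (induction A rule: infinite_finite_induct) (auto intro: padic_cont_add padic_cont_const)

lemma padic_cont_prod:
  "prime l \<Longrightarrow> (\<And>i. i \<in> A \<Longrightarrow> padic_cont l t (f i)) \<Longrightarrow> padic_cont l t (\<lambda>x. \<Prod>i\<in>A. f i x)"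
  by (induction A rule: infinite_finite_induct) (auto intro: padic_cont_mult padic_cont_const)

text \<open>For fixed \<open>i\<close> this is a polynomial in \<open>x\<close> with rational
  coefficients; the factor \<open>1 / fact i\<close> is just a constant.\<close>

lemma padic_cont_gbinomial:
  assumes "prime l"
  shows "padic_cont l t (\<lambda>x. x gchoose i)"
proof -
  have "(\<lambda>x :: rat. x gchoose i) = (\<lambda>x. (\<Prod>j = 0..<i. x + - of_nat j) * (1 / fact i))"
    by (simp add: gbinomial_prod_rev fun_eq_iff)
  then show ?thesis
    by (simp only:) (intro assms padic_cont_mult padic_cont_prod padic_cont_add padic_cont_ident
        padic_cont_const)
qed

text \<open>The coefficient depends on finitely many factors only, and each coefficient of a factor
  is a binomial coefficient in \<open>x\<close> up to sign, or 0.\<close>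

lemma padic_cont_p_frac:
  assumes "prime l"
  shows "padic_cont l t (\<lambda>x. p_frac x n)"
proof -
  have factor: "padic_cont l t (\<lambda>x. fps_nth (one_minus_q_powr (Suc i) x) j)" for i j
    by (cases "Suc i dvd j")
      (simp_all add: one_minus_q_powr_nth assms padic_cont_mult padic_cont_gbinomial padic_cont_const)
  have "padic_cont l t (\<lambda>x. fps_nth (\<Prod>i\<le>N. one_minus_q_powr (Suc i) x) m)" for N m
  proof (induction N arbitrary: m)
    case 0
    show ?case using factor[of 0] by simp
  next
    case (Suc N)
    show ?case
      unfolding prod.atMost_Suc fps_mult_nth
      by (intro padic_cont_sum padic_cont_mult assms Suc.IH factor)
  qed
  then show ?thesis
    by (simp add: p_frac_eq_finite_prod[OF order.refl])
qed

lemma one_minus_q_powr_of_nat: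
  assumes "j > 0"
  shows "one_minus_q_powr j (of_nat T) = (1 - fps_X ^ j) ^ T"
proof -
  have X: "fps_nth ((- (fps_X ^ j)) :: rat fps) 0 = 0" using assms by simp
  show ?thesis
    unfolding one_minus_q_powr_def fps_binomial_of_nat
    by (subst fps_compose_power[OF X, symmetric]) (simp add: fps_compose_add_distrib fps_X_fps_compose_startby0[OF X])
qed

section \<open>Theorems of Euler and Jacobi\<close>

definition agree :: "nat \<Rightarrow> 'a fps \<Rightarrow> 'a fps \<Rightarrow> bool" where
  "agree n f g \<longleftrightarrow> (\<forall>i<n. fps_nth f i = fps_nth g i)"

lemma agree_refl [simp]: "agree n f f"
  and agree_sym: "agree n f g \<Longrightarrow> agree n g f"
  and agree_trans [trans]: "agree n f g \<Longrightarrow> agree n g h \<Longrightarrow> agree n f h"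
  and agree_mono: "agree n f g \<Longrightarrow> m \<le> n \<Longrightarrow> agree m f g"
  by (auto simp: agree_def)

lemma agree_mult:
  fixes f :: "'a :: semiring_1 fps"
  assumes "agree n f f'" "agree n g g'"
  shows "agree n (f * g) (f' * g')"
  using assms by (auto simp: agree_def fps_mult_nth intro!: sum.cong)

lemma agree_diff:
  fixes f :: "'a :: group_add fps"
  shows "agree n f f' \<Longrightarrow> agree n g g' \<Longrightarrow> agree n (f - g) (f' - g')"
  by (simp add: agree_def)

lemma agree_power:
  fixes f :: "'a :: semiring_1 fps"
  shows "agree n f g \<Longrightarrow> agree n (f ^ k) (g ^ k)"
  by (induction k) (auto intro: agree_mult)

lemma agree_sum:
  fixes f :: "'b \<Rightarrow> 'a :: comm_monoid_add fps"
  shows "(\<And>i. i \<in> A \<Longrightarrow> agree n (f i) (g i)) \<Longrightarrow> agree n (sum f A) (sum g A)"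
  by (auto simp: agree_def fps_sum_nth intro!: sum.cong)

lemma agree_mult_X_power:
  fixes f :: "'a :: comm_semiring_1 fps"
  assumes "agree m f g" "n \<le> k + m"
  shows "agree n (fps_X ^ k * f) (fps_X ^ k * g)"
  using assms by (auto simp: agree_def fps_X_power_mult_nth)

text \<open>As \<open>e\<close> has constant term 1, the coefficient of index \<open>i\<close> in
  \<open>e * h\<close> is that of \<open>h\<close> plus a combination of earlier coefficients of
  \<open>h\<close>, so strong induction applies.\<close>

lemma agree_mult_left_cancel:
  fixes e :: "'a :: idom fps"
  assumes "agree n (e * f) (e * g)" "fps_nth e 0 = 1"
  shows "agree n f g"
  unfolding agree_def
proof (intro allI impI)
  fix i assume "i < n"
  then show "fps_nth f i = fps_nth g i"
  proof (induction i rule: less_induct)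
    case (less i)
    have nth: "fps_nth (e * h) i = fps_nth h i + (\<Sum>j=1..i. fps_nth e j * fps_nth h (i - j))" for h
      using assms(2) by (simp add: fps_mult_nth sum.atLeast_Suc_atMost)
    have "(\<Sum>j=1..i. fps_nth e j * fps_nth f (i - j)) = (\<Sum>j=1..i. fps_nth e j * fps_nth g (i - j))"
      using less by (intro sum.cong) auto
    with nth[of f] nth[of g] assms(1) less.prems show ?case
      by (simp add: agree_def)
  qed
qed

definition qpoch :: "nat \<Rightarrow> int fps" where
  "qpoch n = (\<Prod>i=1..n. 1 - fps_X ^ i)"

text \<open>The infinite product read off diagonally: factors beyond the n-th are 1 modulo q^(n+1)
  and cannot change the n-th coefficient.\<close>

definition euler :: "int fps" where
  "euler = Abs_fps (\<lambda>n. fps_nth (qpoch n) n)"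

lemma qpoch_0 [simp]: "qpoch 0 = 1"
  and qpoch_Suc: "qpoch (Suc n) = qpoch n * (1 - fps_X ^ Suc n)"
  by (simp_all add: qpoch_def)

lemma agree_euler_qpoch: "agree (Suc n) euler (qpoch n)"
  unfolding agree_def
proof (intro allI impI)
  fix i assume "i < Suc n"
  then have "i \<le> n" by simp
  then have "fps_nth (qpoch n) i = fps_nth (qpoch i) i"
  proof (induction n rule: dec_induct)
    case (step n)
    have "qpoch (Suc n) = qpoch n - fps_X ^ Suc n * qpoch n"
      by (simp add: qpoch_Suc algebra_simps)
    with step show ?case by (simp add: fps_X_power_mult_nth del: power_Suc)
  qed simp
  then show "fps_nth euler i = fps_nth (qpoch n) i" by (simp add: euler_def)
qed

lemma euler_nth_0 [simp]: "fps_nth euler 0 = 1"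
  by (simp add: euler_def)

lemma Suc_choose_two: "Suc n choose 2 = (n choose 2) + n"
  by (simp add: numeral_2_eq_2)

lemma two_times_Suc_choose_two: "2 * (Suc n choose 2) = n * (n + 1)"
  by (induction n) (simp_all add: Suc_choose_two[of "Suc _"] algebra_simps numeral_2_eq_2)

text \<open>Shanks's finite form of the pentagonal number theorem. Passing from \<open>n\<close> to
  \<open>n + 1\<close> changes each summand on the left by a difference
  \<open>U (Suc s) - U s\<close>, so the change telescopes.\<close>

lemma shanks_identity:
  "(\<Sum>s\<le>n. (-1) ^ s * (\<Prod>i\<in>{s<..n}. 1 - fps_X ^ i) * fps_X ^ (n * s + (Suc s choose 2))) =
   (\<Sum>s\<in>{- int n..int n}. (-1) ^ nat \<bar>s\<bar> * (fps_X :: 'a :: comm_ring_1 fps) ^ nat (s * (3 * s + 1) div 2))"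
proof (induction n)
  case 0
  show ?case by (simp add: numeral_2_eq_2)
next
  case (Suc n)
  let ?X = "fps_X :: 'a fps"
  define R where "R = (\<lambda>s n. \<Prod>i\<in>{s<..n}. 1 - ?X ^ i)"
  \<comment> \<open>For \<open>s > 0\<close> the product \<open>R (s - 1) n\<close> is
    \<open>R s n\<close> times 1 - q^s. That factor vanishes at \<open>s = 0\<close>, which explains
    the value 0 chosen there.\<close>
  define U where
    "U = (\<lambda>s. (-1) ^ s * (if s = 0 then 0 else R (s - 1) n) * ?X ^ (n * s + (Suc s choose 2)))"
  have R_Suc: "R s (Suc n) = R s n * (1 - ?X ^ Suc n)" if "s \<le> n" for s
  proof -
    have "{s<..Suc n} = insert (Suc n) {s<..n}" using that by auto
    then show ?thesis by (simp add: R_def mult.commute)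
  qed
  have U_Suc: "U (Suc s) = - ((-1) ^ s * R s n * ?X ^ (n * s + n + (Suc s choose 2) + Suc s))" for s
    by (simp add: U_def Suc_choose_two[of "Suc s"] algebra_simps)
  have U: "U s = (-1) ^ s * (R s n * (1 - ?X ^ s)) * ?X ^ (n * s + (Suc s choose 2))" if "s \<le> n" for s
  proof (cases s)
    case (Suc r)
    have "{r<..n} = insert s {s<..n}" using Suc that by auto
    then show ?thesis by (simp add: U_def R_def Suc mult.commute)
  qed (simp add: U_def)
  have step: "(-1) ^ s * R s (Suc n) * ?X ^ (Suc n * s + (Suc s choose 2)) =
      (-1) ^ s * R s n * ?X ^ (n * s + (Suc s choose 2)) + (U (Suc s) - U s)" if "s \<le> n" for s
    unfolding R_Suc[OF that] U_Suc U[OF that] by (simp add: power_add algebra_simps)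
  have "(\<Sum>s\<le>Suc n. (-1) ^ s * R s (Suc n) * ?X ^ (Suc n * s + (Suc s choose 2))) =
      (\<Sum>s\<le>n. (-1) ^ s * R s n * ?X ^ (n * s + (Suc s choose 2)) + (U (Suc s) - U s)) +
      (-1) ^ Suc n * R (Suc n) (Suc n) * ?X ^ (Suc n * Suc n + (Suc (Suc n) choose 2))"
    unfolding sum.atMost_Suc using step by (intro arg_cong2[where f = "(+)"] sum.cong) auto
  also have "(\<Sum>s\<le>n. (-1) ^ s * R s n * ?X ^ (n * s + (Suc s choose 2)) + (U (Suc s) - U s)) =
      (\<Sum>s\<le>n. (-1) ^ s * R s n * ?X ^ (n * s + (Suc s choose 2))) + (U (Suc n) - U 0)"
    unfolding sum.distrib using sum_lessThan_telescope[of U "Suc n"] by (simp only: lessThan_Suc_atMost)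
  also have "R (Suc n) (Suc n) = 1" by (simp add: R_def)
  also have "U (Suc n) - U 0 = (-1) ^ Suc n * ?X ^ (Suc n * n + (Suc (Suc n) choose 2))"
    unfolding U_Suc by (simp add: U_def R_def Suc_choose_two[of "Suc n"] algebra_simps)
  also have "(\<Sum>s\<le>n. (-1) ^ s * R s n * ?X ^ (n * s + (Suc s choose 2))) =
      (\<Sum>s\<in>{- int n..int n}. (-1) ^ nat \<bar>s\<bar> * ?X ^ nat (s * (3 * s + 1) div 2))"
    using Suc.IH by (simp add: R_def)
  finally have main: "(\<Sum>s\<le>Suc n. (-1) ^ s * R s (Suc n) * ?X ^ (Suc n * s + (Suc s choose 2))) =
      (\<Sum>s\<in>{- int n..int n}. (-1) ^ nat \<bar>s\<bar> * ?X ^ nat (s * (3 * s + 1) div 2)) +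
      (-1) ^ Suc n * ?X ^ (Suc n * n + (Suc (Suc n) choose 2)) +
      (-1) ^ Suc n * 1 * ?X ^ (Suc n * Suc n + (Suc (Suc n) choose 2))" .
  have tri: "2 * int (Suc (Suc n) choose 2) = (1 + int n) * (2 + int n)"
    using arg_cong[OF two_times_Suc_choose_two[of "Suc n"], of int]
    by (simp del: binomial_Suc_Suc add: algebra_simps)
  \<comment> \<open>The telescoped remainder \<open>U (Suc n)\<close> is the pentagonal term of
    index -(n+1); the new top summand, treated in \<open>e2\<close>, is the one of index
    n+1.\<close>
  have e1: "nat (- int (Suc n) * (3 * - int (Suc n) + 1) div 2) = Suc n * n + (Suc (Suc n) choose 2)"
  proof -
    have "- int (Suc n) * (3 * - int (Suc n) + 1) = 2 * int (Suc n * n + (Suc (Suc n) choose 2))"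
      using tri by (simp add: algebra_simps del: binomial_Suc_Suc)
    then show ?thesis by (simp only: nonzero_mult_div_cancel_left nat_int zero_neq_numeral not_False_eq_True)
  qed
  have e2: "nat (int (Suc n) * (3 * int (Suc n) + 1) div 2) = Suc n * Suc n + (Suc (Suc n) choose 2)"
  proof -
    have "int (Suc n) * (3 * int (Suc n) + 1) = 2 * int (Suc n * Suc n + (Suc (Suc n) choose 2))"
      using tri by (simp add: algebra_simps del: binomial_Suc_Suc)
    then show ?thesis by (simp only: nonzero_mult_div_cancel_left nat_int zero_neq_numeral not_False_eq_True)
  qed
  have set: "{- int (Suc n)..int (Suc n)} =
      insert (- int (Suc n)) (insert (int (Suc n)) {- int n..int n})" by auto
  have "(\<Sum>s\<in>{- int (Suc n)..int (Suc n)}. (-1) ^ nat \<bar>s\<bar> * ?X ^ nat (s * (3 * s + 1) div 2)) =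
      (-1) ^ Suc n * ?X ^ (Suc n * n + (Suc (Suc n) choose 2)) +
      ((-1) ^ Suc n * ?X ^ (Suc n * Suc n + (Suc (Suc n) choose 2)) +
      (\<Sum>s\<in>{- int n..int n}. (-1) ^ nat \<bar>s\<bar> * ?X ^ nat (s * (3 * s + 1) div 2)))"
    unfolding set
    by (subst sum.insert, simp, simp, subst sum.insert, simp, simp)
      (simp only: e1 e2 abs_minus_cancel abs_of_nat nat_int)
  with main show ?case by (simp only: R_def mult_1_right add_ac)
qed

text \<open>Compare coefficients of q^m in Shanks's identity for \<open>n = m\<close>. On the left
  only \<open>s = 0\<close> contributes, because all other summands are divisible by
  q^(m+1).\<close>

theorem euler_pentagonal:
  "fps_nth euler m = (\<Sum>s | s * (3 * s + 1) = 2 * int m. (-1) ^ nat \<bar>s\<bar>)"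
proof -
  let ?F = "\<lambda>s. (-1) ^ s * (\<Prod>i\<in>{s<..m}. 1 - fps_X ^ i) * fps_X ^ (m * s + (Suc s choose 2)) :: int fps"
  have zero: "fps_nth (?F s) m = 0" if "s \<noteq> 0" for s
  proof -
    have "m < m * s + (Suc s choose 2)"
      using that by (cases s; cases m) (auto simp: numeral_2_eq_2)
    then show ?thesis by (simp add: fps_X_power_mult_right_nth del: binomial_Suc_Suc)
  qed
  have F0: "?F 0 = qpoch m"
    by (simp add: qpoch_def numeral_2_eq_2 atLeastSucAtMost_greaterThanAtMost)
  have "fps_nth (\<Sum>s\<le>m. ?F s) m = (\<Sum>s\<le>m. if s = 0 then fps_nth (qpoch m) m else 0)"
    unfolding fps_sum_nth using zero F0 by (intro sum.cong) auto
  also have "\<dots> = fps_nth euler m" by (simp add: euler_def)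
  finally have "fps_nth euler m =
      (\<Sum>s\<in>{- int m..int m}. fps_nth ((-1) ^ nat \<bar>s\<bar> * fps_X ^ nat (s * (3 * s + 1) div 2)) m)"
    unfolding shanks_identity by (simp add: fps_sum_nth)
  also have "\<dots> = (\<Sum>s\<in>{- int m..int m}. if s * (3 * s + 1) = 2 * int m then (-1) ^ nat \<bar>s\<bar> else 0)"
  proof (intro sum.cong refl)
    fix s :: int
    obtain c where c: "s * (3 * s + 1) = 2 * c"
      by (metis dvdE even_add even_mult_iff odd_one odd_numeral)
    have nonneg: "s * (3 * s + 1) \<ge> 0" by (cases "s \<ge> 0") (auto intro: mult_nonpos_nonpos)
    have "m = nat (s * (3 * s + 1) div 2) \<longleftrightarrow> s * (3 * s + 1) = 2 * int m"
      using nonneg unfolding c by auto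
    moreover have "fps_nth ((-1) ^ j * fps_X ^ e :: int fps) m = (if m = e then (-1) ^ j else 0)" for j e
      by (cases "even j") (auto simp: fps_X_power_nth)
    ultimately show "fps_nth ((-1) ^ nat \<bar>s\<bar> * (fps_X :: int fps) ^ nat (s * (3 * s + 1) div 2)) m =
        (if s * (3 * s + 1) = 2 * int m then (-1) ^ nat \<bar>s\<bar> else 0)"
      by simp
  qed
  also have "\<dots> = (\<Sum>s | s \<in> {- int m..int m} \<and> s * (3 * s + 1) = 2 * int m. (-1) ^ nat \<bar>s\<bar>)"
    by (subst sum.inter_filter) simp_all
  also have "{s. s \<in> {- int m..int m} \<and> s * (3 * s + 1) = 2 * int m} =
      {s. s * (3 * s + 1) = 2 * int m}"
  proof -
    \<comment> \<open>Since 3s^2 + s >= 3|s| - |s| = 2|s|, every solution already lies in the finite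
      summation range.\<close>
    have "- int m \<le> s \<and> s \<le> int m" if "s * (3 * s + 1) = 2 * int m" for s
    proof -
      have sq: "\<bar>s\<bar> \<le> s * s"
      proof (cases "s = 0")
        case False
        then have "1 * \<bar>s\<bar> \<le> \<bar>s\<bar> * \<bar>s\<bar>" by (intro mult_right_mono) auto
        then show ?thesis by simp
      qed simp
      have "s * (3 * s + 1) = 3 * (s * s) + s" by (simp add: algebra_simps)
      with that sq show ?thesis by linarith
    qed
    then show ?thesis by auto
  qed
  finally show ?thesis .
qed

section \<open>Gaussian binomial coefficients and Jacobi's identity\<close>

fun qbinom :: "'a :: comm_ring_1 \<Rightarrow> nat \<Rightarrow> nat \<Rightarrow> 'a" where
  "qbinom q m 0 = 1"
| "qbinom q 0 (Suc k) = 0"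
| "qbinom q (Suc m) (Suc k) = qbinom q m (Suc k) + q ^ (m - k) * qbinom q m k"

lemma qbinom_eq_0: "m < k \<Longrightarrow> qbinom q m k = 0"
  by (induction q m k rule: qbinom.induct) auto

text \<open>The q-binomial theorem for the product of the y - q^i z as a polynomial in z. Splitting
  off the last factor reproduces the Pascal recursion that defines \<open>qbinom\<close>.\<close>

lemma coeff_qbinomial:
  "coeff (\<Prod>i<m. [:y, - (q ^ i):]) k = (-1) ^ k * q ^ (k choose 2) * qbinom q m k * y ^ (m - k)"
proof (induction m arbitrary: k)
  case 0
  show ?case by (cases k) (auto simp: coeff_1 numeral_2_eq_2)
next
  case (Suc m)
  have *: "coeff (\<Prod>i<Suc m. [:y, - (q ^ i):]) k = y * coeff (\<Prod>i<m. [:y, - (q ^ i):]) k -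
      q ^ m * (case k of 0 \<Rightarrow> 0 | Suc j \<Rightarrow> coeff (\<Prod>i<m. [:y, - (q ^ i):]) j)"
    by (simp add: mult.commute[of _ "[:y, _:]"] coeff_pCons split: nat.split)
  show ?case
  proof (cases k)
    case 0
    then show ?thesis unfolding * Suc.IH by (simp add: numeral_2_eq_2)
  next
    case (Suc j)
    \<comment> \<open>The exponents of \<open>y\<close> and \<open>q\<close> are truncated
      differences, so the boundary \<open>j = m\<close> and the vanishing range \<open>j > m\<close>
      are separated.\<close>
    consider "j < m" | "j = m" | "j > m" by linarith
    then show ?thesis
    proof cases
      case 1
      then obtain d where d: "m = Suc (j + d)" using less_imp_Suc_add by blast
      show ?thesis unfolding * Suc.IH
        by (simp add: Suc d Suc_choose_two power_add algebra_simps)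
    next
      case 2
      then show ?thesis unfolding * Suc.IH
        by (simp add: Suc Suc_choose_two power_add qbinom_eq_0 algebra_simps)
    next
      case 3
      then show ?thesis unfolding * Suc.IH by (simp add: Suc qbinom_eq_0)
    qed
  qed
qed

text \<open>The quotient formula for Gaussian binomials without division. The Pascal recursion
  reduces it to (1 - q^(m-j)) + q^(m-j) (1 - q^(j+1)) = 1 - q^(m+1).\<close>

lemma qbinom_qpoch:
  "k \<le> m \<Longrightarrow> qbinom fps_X m k * qpoch k * qpoch (m - k) = qpoch m"
proof (induction m arbitrary: k)
  case (Suc m)
  show ?case
  proof (cases k)
    case (Suc j)
    with Suc.prems have j: "j \<le> m" by simp
    have 1: "qbinom fps_X m (Suc j) * qpoch (Suc j) * qpoch (m - j) = qpoch m * (1 - fps_X ^ (m - j))"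
    proof (cases "j = m")
      case False
      with j have "m - j = Suc (m - Suc j)" by simp
      then have "qpoch (m - j) = qpoch (m - Suc j) * (1 - fps_X ^ (m - j))"
        by (metis qpoch_Suc)
      moreover have "qbinom fps_X m (Suc j) * qpoch (Suc j) * qpoch (m - Suc j) = qpoch m"
        using False j by (intro Suc.IH) simp
      ultimately show ?thesis by (metis mult.assoc)
    qed (simp add: qbinom_eq_0)
    have "qbinom fps_X (Suc m) k * qpoch k * qpoch (Suc m - k) =
        qbinom fps_X m (Suc j) * qpoch (Suc j) * qpoch (m - j) +
        fps_X ^ (m - j) * (1 - fps_X ^ Suc j) * (qbinom fps_X m j * qpoch j * qpoch (m - j))"
      by (simp add: Suc qpoch_Suc algebra_simps)
    also have "\<dots> = qpoch m * (1 - fps_X ^ (m - j) * fps_X ^ Suc j)"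
      unfolding 1 Suc.IH[OF j] by (simp add: algebra_simps)
    also have "fps_X ^ (m - j) * fps_X ^ Suc j = (fps_X ^ Suc m :: int fps)"
      using j by (simp flip: power_add del: power_Suc)
    finally show ?thesis by (simp add: qpoch_Suc)
  qed simp
qed simp

text \<open>A Gaussian binomial approximates 1/E when both \<open>k\<close> and \<open>m - k\<close>
  are large: modulo q^(j+1) all three factors in \<open>qbinom_qpoch\<close> may be replaced by
  E.\<close>

lemma agree_qbinom_euler:
  assumes "j \<le> k" "j + k \<le> m"
  shows "agree (Suc j) (qbinom fps_X m k * euler) 1"
proof (rule agree_mult_left_cancel)
  have "agree (Suc j) (qbinom fps_X m k * euler * euler) (qbinom fps_X m k * qpoch k * qpoch (m - k))"
    using assms by (intro agree_mult agree_refl agree_mono[OF agree_euler_qpoch]) auto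
  also have "qbinom fps_X m k * qpoch k * qpoch (m - k) = qpoch m"
    using assms by (intro qbinom_qpoch) simp
  also have "agree (Suc j) (qpoch m) euler"
    using assms by (intro agree_sym[OF agree_mono[OF agree_euler_qpoch]]) simp
  finally show "agree (Suc j) (euler * (qbinom fps_X m k * euler)) (euler * 1)"
    by (simp add: mult_ac)
qed simp

lemma poly_pderiv_1:
  assumes "degree p \<le> n"
  shows "poly (pderiv p) 1 = (\<Sum>k\<le>n. of_nat k * coeff p k)"
proof -
  have "poly (pderiv p) 1 = poly (pderiv (\<Sum>k\<le>n. monom (coeff p k) k)) 1"
    using assms by (simp add: poly_as_sum_of_monoms')
  then show ?thesis
    by (simp add: higher_pderiv_sum[of 1, simplified] poly_sum pderiv_monom poly_monom)
qed

text \<open>Pairs the indices symmetric about n + 1/2. In the next identity the coefficients at such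
  a pair carry the same power of q and opposite signs.\<close>

lemma sum_atMost_double_Suc:
  fixes f :: "nat \<Rightarrow> 'a :: comm_monoid_add"
  shows "(\<Sum>k\<le>2 * n + 1. f k) = (\<Sum>i\<le>n. f (n - i) + f (n + 1 + i))"
proof -
  have "{..2 * n + 1} = {..n} \<union> {n + 1..2 * n + 1}" by auto
  then have "(\<Sum>k\<le>2 * n + 1. f k) = (\<Sum>k\<le>n. f k) + (\<Sum>k=n + 1..2 * n + 1. f k)"
    by (simp add: sum.union_disjoint)
  also have "(\<Sum>k\<le>n. f k) = (\<Sum>i\<le>n. f (n - i))"
    by (rule sum.reindex_bij_witness[of _ "\<lambda>i. n - i" "\<lambda>i. n - i"]) auto
  also have "(\<Sum>k=n + 1..2 * n + 1. f k) = (\<Sum>i\<le>n. f (n + 1 + i))"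
    using sum.shift_bounds_cl_nat_ivl[of f 0 "n + 1" n] by (simp add: atMost_atLeast0 add_ac mult_2)
  finally show ?thesis by (simp add: sum.distrib)
qed

text \<open>
  Obtained by differentiating the $q$-binomial theorem for $\prod_{i \le 2n} (q^n - z q^i)$ at its
  root $z = 1$.
\<close>
lemma finite_jacobi_identity:
  "(\<Sum>i\<le>n. (-1) ^ i * fps_X ^ (Suc i choose 2) *
     (of_nat (n + 1 + i) * qbinom fps_X (2 * n + 1) (n + 1 + i) -
      of_nat (n - i) * qbinom fps_X (2 * n + 1) (n - i))) = (qpoch n)\<^sup>2"
proof -
  let ?X = "fps_X :: int fps"
  define P where "P = (\<Prod>i<2 * n + 1. [:?X ^ n, - (?X ^ i):])"
  define Q where "Q = (\<Prod>i\<in>{..<2 * n + 1} - {n}. [:?X ^ n, - (?X ^ i):])"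
  define C where "C = (n choose 2) + n * n"
  \<comment> \<open>The split-off factor q^n - z q^n vanishes at z = 1, so the derivative of
    \<open>P\<close> there is -q^n times the value of \<open>Q\<close>.\<close>
  have P: "P = [:?X ^ n, - (?X ^ n):] * Q"
    unfolding P_def Q_def by (rule prod.remove) auto
  have Q1: "poly Q 1 = (-1) ^ n * ?X ^ C * (qpoch n)\<^sup>2"
  proof -
    have split: "{..<2 * n + 1} - {n} = {..<n} \<union> {n + 1..<n + (n + 1)}" by auto
    have A: "(\<Prod>i<n. ?X ^ n - ?X ^ i) = (-1) ^ n * ?X ^ (n choose 2) * qpoch n"
    proof -
      have "(\<Prod>i<n. ?X ^ n - ?X ^ i) = (\<Prod>i<n. - 1 * ?X ^ i * (1 - ?X ^ (n - i)))"
        by (intro prod.cong refl) (simp add: algebra_simps flip: power_add)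
      also have "\<dots> = (\<Prod>i<n. - 1) * (\<Prod>i<n. ?X ^ i) * (\<Prod>i<n. 1 - ?X ^ (n - i))"
        by (simp only: prod.distrib)
      also have "(\<Prod>i<n. ?X ^ i) = ?X ^ (n choose 2)"
        by (induction n) (simp_all add: Suc_choose_two power_add numeral_2_eq_2)
      also have "(\<Prod>i<n. 1 - ?X ^ (n - i)) = qpoch n"
        unfolding qpoch_def
        by (rule prod.reindex_bij_witness[of _ "\<lambda>i. n - i" "\<lambda>i. n - i"]) auto
      finally show ?thesis by simp
    qed
    have B: "(\<Prod>i=n + 1..<n + (n + 1). ?X ^ n - ?X ^ i) = ?X ^ (n * n) * qpoch n"
    proof -
      have "(\<Prod>i=n + 1..<n + (n + 1). ?X ^ n - ?X ^ i) = (\<Prod>i=1..n. ?X ^ n * (1 - ?X ^ i))"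
        by (rule prod.reindex_bij_witness[of _ "\<lambda>i. n + i" "\<lambda>i. i - n"])
          (auto simp: algebra_simps simp flip: power_add)
      then show ?thesis by (simp add: prod.distrib qpoch_def power_mult)
    qed
    have "poly Q 1 = (\<Prod>i<n. ?X ^ n - ?X ^ i) * (\<Prod>i=n + 1..<n + (n + 1). ?X ^ n - ?X ^ i)"
      unfolding Q_def split poly_prod by (subst prod.union_disjoint) auto
    then show ?thesis
      unfolding A B by (simp add: C_def power_add power2_eq_square algebra_simps)
  qed
  have "degree P \<le> (\<Sum>i<2 * n + 1. degree [:?X ^ n, - (?X ^ i):])"
    unfolding P_def by (rule order.trans[OF degree_prod_sum_le]) simp_all
  also have "\<dots> \<le> (\<Sum>i<2 * n + 1. 1)"
    by (rule sum_mono) simp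
  finally have "degree P \<le> 2 * n + 1" by simp
  from poly_pderiv_1[OF this]
  have deriv: "poly (pderiv P) 1 = (\<Sum>i\<le>n. of_nat (n - i) * coeff P (n - i) +
      of_nat (n + 1 + i) * coeff P (n + 1 + i))"
    unfolding sum_atMost_double_Suc .
  \<comment> \<open>Exponents are compared after doubling, where the triangular numbers become
    polynomials; writing n = d + i removes the truncated differences, and \<open>halve\<close>
    undoes the doubling.\<close>
  have tri: "2 * ((i choose 2) + i) = i * (i + 1)" for i
    using two_times_Suc_choose_two[of i] by (simp only: Suc_choose_two)
  have halve: "a + e = b + f + m + t"
    if "2 * (a + c) + 2 * e = 2 * (b + m) + 2 * f + 2 * t + 2 * c" for a b c e f m t :: nat
    using that by simp
  have c1: "coeff P (n - i) = - ((-1) ^ n * ?X ^ (C + n)) *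
      ((-1) ^ i * ?X ^ (Suc i choose 2) * - qbinom ?X (2 * n + 1) (n - i))" if "i \<le> n" for i
  proof -
    obtain d where d: "n = d + i"
      by (rule that[of "n - i"]) (use \<open>i \<le> n\<close> in simp)
    have "2 * ((d choose 2) + d) + 2 * ((d + i) * (d + i + 1 + i)) =
        2 * (((d + i) choose 2) + (d + i)) + 2 * ((d + i) * (d + i)) + 2 * ((i choose 2) + i) + 2 * d"
      unfolding tri by (simp add: algebra_simps)
    then have e': "(d choose 2) + (d + i) * (d + i + 1 + i) =
        ((d + i) choose 2) + (d + i) * (d + i) + (d + i) + ((i choose 2) + i)"
      by (rule halve)
    have h: "n - i = d" "2 * n + 1 - d = d + i + 1 + i"
      unfolding d by simp_all
    have e: "(n - i choose 2) + n * (2 * n + 1 - (n - i)) = C + n + (Suc i choose 2)"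
      unfolding h C_def Suc_choose_two unfolding d by (rule e')
    have sgn: "(-1 :: int fps) ^ (n - i) = (-1) ^ n * (-1) ^ i"
      unfolding d by (simp add: power_add)
    have "coeff P (n - i) = (-1) ^ (n - i) * qbinom ?X (2 * n + 1) (n - i) *
        ?X ^ ((n - i choose 2) + n * (2 * n + 1 - (n - i)))"
      unfolding P_def coeff_qbinomial by (simp only: power_add power_mult mult_ac)
    then show ?thesis
      unfolding e sgn by (simp only: power_add mult_minus_left mult_minus_right minus_minus mult_ac)
  qed
  have c2: "coeff P (n + 1 + i) = - ((-1) ^ n * ?X ^ (C + n)) *
      ((-1) ^ i * ?X ^ (Suc i choose 2) * qbinom ?X (2 * n + 1) (n + 1 + i))" if "i \<le> n" for i
  proof -
    obtain d where d: "n = d + i"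
      by (rule that[of "n - i"]) (use \<open>i \<le> n\<close> in simp)
    have "2 * ((d + i + i choose 2) + (d + i + i) + 0) + 2 * ((d + i) * d) =
        2 * (((d + i) choose 2) + (d + i)) + 2 * ((d + i) * (d + i)) + 2 * ((i choose 2) + i) + 2 * 0"
      unfolding tri add_0_right by (simp add: algebra_simps)
    then have e': "(d + i + i choose 2) + (d + i + i) + (d + i) * d =
        ((d + i) choose 2) + (d + i) * (d + i) + (d + i) + ((i choose 2) + i)"
      by (rule halve)
    have h: "2 * n + 1 - (n + 1 + i) = d"
      unfolding d by simp
    have s: "n + 1 + i = Suc (n + i)" by simp
    have e: "(n + 1 + i choose 2) + n * (2 * n + 1 - (n + 1 + i)) = C + n + (Suc i choose 2)"
      unfolding h unfolding s C_def Suc_choose_two unfolding d by (rule e')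
    have sgn: "(-1 :: int fps) ^ (n + 1 + i) = - ((-1) ^ n * (-1) ^ i)"
      by (simp add: power_add)
    have "coeff P (n + 1 + i) = (-1) ^ (n + 1 + i) * qbinom ?X (2 * n + 1) (n + 1 + i) *
        ?X ^ ((n + 1 + i choose 2) + n * (2 * n + 1 - (n + 1 + i)))"
      unfolding P_def coeff_qbinomial by (simp only: power_add power_mult mult_ac)
    then show ?thesis
      unfolding e sgn by (simp only: power_add mult_minus_left mult_minus_right minus_minus mult_ac)
  qed
  have "- (?X ^ n) * poly Q 1 = poly (pderiv P) 1"
    unfolding P pderiv_mult by (simp add: pderiv_pCons)
  also have "\<dots> = - ((-1) ^ n * ?X ^ (C + n)) * (\<Sum>i\<le>n. (-1) ^ i * ?X ^ (Suc i choose 2) *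
      (of_nat (n + 1 + i) * qbinom ?X (2 * n + 1) (n + 1 + i) -
       of_nat (n - i) * qbinom ?X (2 * n + 1) (n - i)))"
    unfolding deriv sum_distrib_left
  proof (intro sum.cong refl)
    fix i assume "i \<in> {..n}"
    then have i: "i \<le> n" by simp
    show "of_nat (n - i) * coeff P (n - i) + of_nat (n + 1 + i) * coeff P (n + 1 + i) =
        - ((-1) ^ n * ?X ^ (C + n)) * ((-1) ^ i * ?X ^ (Suc i choose 2) *
        (of_nat (n + 1 + i) * qbinom ?X (2 * n + 1) (n + 1 + i) -
         of_nat (n - i) * qbinom ?X (2 * n + 1) (n - i)))"
      unfolding c1[OF i] c2[OF i] right_diff_distrib
      by (simp only: mult_minus_left mult_minus_right minus_minus mult_ac diff_conv_add_uminus add_ac)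
  qed
  finally have "- ((-1) ^ n * ?X ^ (C + n)) * (qpoch n)\<^sup>2 = \<dots>"
    unfolding Q1 by (simp add: power_add algebra_simps)
  then show ?thesis by simp
qed

text \<open>Multiply the finite identity by E. To order q^(m+1) each \<open>qbinom\<close> times E
  may be replaced by 1, and the weights combine to (m+1+i) - (m-i) = 2i+1.\<close>

theorem euler_cubed:
  "fps_nth (euler ^ 3) m = (\<Sum>i | i * (i + 1) = 2 * m. (-1) ^ i * (2 * int i + 1))"
proof -
  let ?X = "fps_X :: int fps"
  let ?q = "\<lambda>k. qbinom ?X (2 * m + 1) k * euler"
  have "agree (Suc m) (euler ^ 3) (euler * (qpoch m)\<^sup>2)"
    unfolding power3_eq_cube power2_eq_square mult.assoc
    by (intro agree_mult agree_refl agree_euler_qpoch)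
  also have "euler * (qpoch m)\<^sup>2 = (\<Sum>i\<le>m. (-1) ^ i *
      (of_nat (m + 1 + i) * (?X ^ (Suc i choose 2) * ?q (m + 1 + i)) -
       of_nat (m - i) * (?X ^ (Suc i choose 2) * ?q (m - i))))"
    unfolding finite_jacobi_identity[symmetric] sum_distrib_left by (simp add: algebra_simps)
  also have "agree (Suc m) \<dots> (\<Sum>i\<le>m. (-1) ^ i *
      (of_nat (m + 1 + i) * (?X ^ (Suc i choose 2) * 1) - of_nat (m - i) * (?X ^ (Suc i choose 2) * 1)))"
  proof (rule agree_sum)
    fix i assume "i \<in> {..m}"
    then have i: "i \<le> m" by simp
    \<comment> \<open>The replacement by 1 is valid only modulo q^(m-i+1); the triangular power of
      q, of exponent at least \<open>i\<close>, makes up the difference.\<close>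
    have le: "Suc m \<le> (Suc i choose 2) + Suc (m - i)"
      using i by (simp add: Suc_choose_two)
    have "agree (Suc m) (?X ^ (Suc i choose 2) * ?q (m + 1 + i)) (?X ^ (Suc i choose 2) * 1)"
      "agree (Suc m) (?X ^ (Suc i choose 2) * ?q (m - i)) (?X ^ (Suc i choose 2) * 1)"
      by (intro agree_mult_X_power[OF agree_qbinom_euler le]; use i in simp)+
    note * = this
    show "agree (Suc m)
        ((-1) ^ i * (of_nat (m + 1 + i) * (?X ^ (Suc i choose 2) * ?q (m + 1 + i)) -
          of_nat (m - i) * (?X ^ (Suc i choose 2) * ?q (m - i))))
        ((-1) ^ i * (of_nat (m + 1 + i) * (?X ^ (Suc i choose 2) * 1) -
          of_nat (m - i) * (?X ^ (Suc i choose 2) * 1)))"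
      by (intro agree_mult[OF agree_refl agree_diff] agree_mult[OF agree_refl *(1)]
          agree_mult[OF agree_refl *(2)])
  qed
  finally have "fps_nth (euler ^ 3) m = (\<Sum>i\<le>m. fps_nth ((-1) ^ i *
      (of_nat (m + 1 + i) * (?X ^ (Suc i choose 2) * 1) - of_nat (m - i) * (?X ^ (Suc i choose 2) * 1))) m)"
    by (simp add: agree_def fps_sum_nth)
  also have "\<dots> = (\<Sum>i\<le>m. if i * (i + 1) = 2 * m then (-1) ^ i * (2 * int i + 1) else 0)"
  proof (intro sum.cong refl)
    fix i assume "i \<in> {..m}"
    then have "(of_nat (m + 1 + i) :: int fps) - of_nat (m - i) = of_int (2 * int i + 1)"
      by (simp add: of_nat_diff)
    moreover have "(Suc i choose 2) = m \<longleftrightarrow> i * (i + 1) = 2 * m"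
      by (simp only: two_times_Suc_choose_two[symmetric]) simp
    ultimately show "fps_nth ((-1) ^ i * (of_nat (m + 1 + i) * (?X ^ (Suc i choose 2) * 1) -
        of_nat (m - i) * (?X ^ (Suc i choose 2) * 1))) m =
        (if i * (i + 1) = 2 * m then (-1) ^ i * (2 * int i + 1) else 0)"
      unfolding left_diff_distrib[symmetric]
      by (cases "even i") (auto simp: fps_X_power_nth simp del: of_int_add of_int_mult binomial_Suc_Suc)
  qed
  also have "\<dots> = (\<Sum>i | i \<in> {..m} \<and> i * (i + 1) = 2 * m. (-1) ^ i * (2 * int i + 1))"
    by (subst sum.inter_filter) simp_all
  also have "{i. i \<in> {..m} \<and> i * (i + 1) = 2 * m} = {i. i * (i + 1) = 2 * m}"
  proof -
    have "i \<le> m" if "i * (i + 1) = 2 * m" for i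
    proof (cases i)
      case (Suc j)
      have "2 * i \<le> (i + 1) * i" unfolding Suc by (intro mult_right_mono) auto
      with that show ?thesis by (simp add: mult.commute)
    qed simp
    then show ?thesis by auto
  qed
  finally show ?thesis .
qed

section \<open>Dissection modulo 5\<close>

definition residue_part :: "nat \<Rightarrow> int fps \<Rightarrow> int fps" where
  "residue_part r f = Abs_fps (\<lambda>n. if n mod 5 = r mod 5 then fps_nth f n else 0)"

definition on_residue :: "nat \<Rightarrow> int fps \<Rightarrow> bool" where
  "on_residue r f \<longleftrightarrow> (\<forall>n. fps_nth f n \<noteq> 0 \<longrightarrow> n mod 5 = r mod 5)"

lemma residue_part_nth: "fps_nth (residue_part r f) n = (if n mod 5 = r mod 5 then fps_nth f n else 0)"
  by (simp add: residue_part_def)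

lemma on_residue_part: "on_residue r (residue_part r f)"
  by (auto simp: on_residue_def residue_part_nth)

lemma residue_part_add: "residue_part r (f + g) = residue_part r f + residue_part r g"
  and residue_part_diff: "residue_part r (f - g) = residue_part r f - residue_part r g"
  and residue_part_numeral_mult: "residue_part r (numeral c * f) = numeral c * residue_part r f"
  by (auto simp: fps_eq_iff residue_part_nth numeral_fps_const)

lemma residue_part_on_residue:
  "on_residue s f \<Longrightarrow> residue_part r f = (if r mod 5 = s mod 5 then f else 0)"
  by (auto simp: fps_eq_iff residue_part_nth on_residue_def)

lemma on_residue_mult:
  assumes "on_residue r f" "on_residue s g"
  shows "on_residue (r + s) (f * g)"
  unfolding on_residue_def
proof (intro allI impI)
  fix n assume "fps_nth (f * g) n \<noteq> 0"
  then obtain i where i: "i \<le> n" "fps_nth f i \<noteq> 0" "fps_nth g (n - i) \<noteq> 0"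
    unfolding fps_mult_nth by (auto elim!: sum.not_neutral_contains_not_neutral)
  then have "(i + (n - i)) mod 5 = (r + s) mod 5"
    using assms by (intro mod_add_cong) (auto simp: on_residue_def)
  with i show "n mod 5 = (r + s) mod 5" by simp
qed

lemma on_residue_power:
  assumes "on_residue r f"
  shows "on_residue (n * r) (f ^ n)"
proof (induction n)
  case 0
  show ?case by (auto simp: on_residue_def)
next
  case (Suc n)
  then show ?case using on_residue_mult[OF assms Suc] by (simp add: algebra_simps)
qed

lemma residue_part_mult:
  assumes "on_residue 0 f"
  shows "residue_part r (f * g) = f * residue_part r g"
proof (rule fps_ext)
  fix n :: nat
  have "(n - i) mod 5 = n mod 5" if "i \<le> n" "fps_nth f i \<noteq> 0" for i
  proof -
    have "i mod 5 = 0" using assms that(2) by (auto simp: on_residue_def)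
    then obtain j where "i = 5 * j" by auto
    with that(1) have "n mod 5 = (5 * j + (n - i)) mod 5" by simp
    then show ?thesis by (simp only: mod_mult_self4)
  qed
  then have "(if n mod 5 = r mod 5 then fps_nth f i * fps_nth g (n - i) else 0) =
      fps_nth f i * fps_nth (residue_part r g) (n - i)" if "i \<le> n" for i
    using that by (cases "fps_nth f i = 0") (auto simp: residue_part_nth)
  then have "(\<Sum>i=0..n. if n mod 5 = r mod 5 then fps_nth f i * fps_nth g (n - i) else 0) =
      fps_nth (f * residue_part r g) n"
    unfolding fps_mult_nth by (intro sum.cong) auto
  moreover have "fps_nth (residue_part r (f * g)) n =
      (\<Sum>i=0..n. if n mod 5 = r mod 5 then fps_nth f i * fps_nth g (n - i) else 0)"
    by (cases "n mod 5 = r mod 5") (simp_all add: residue_part_nth fps_mult_nth)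
  ultimately show "fps_nth (residue_part r (f * g)) n = fps_nth (f * residue_part r g) n"
    by simp
qed

text \<open>Here 24m + 1 = (6s + 1)^2. In the class s = 4 mod 5 the base is divisible by 5, so
  \<open>m\<close> is determined even modulo 25; the other classes follow by expanding s = 5a +
  r.\<close>

lemma pentagonal_mod_5:
  fixes s :: int
  assumes s: "s * (3 * s + 1) = 2 * int m"
  shows "m mod 5 = 0 \<or> m mod 5 = 2 \<or> m mod 25 = 1 \<and> s mod 5 = 4"
proof -
  have zero: "m mod 5 = 0" if "5 * x = 2 * int m" for x
    using that by presburger
  have two: "m mod 5 = 2" if "5 * x + 4 = 2 * int m" for x
    using that by presburger
  have one: "m mod 25 = 1" if x: "25 * x + 2 = 2 * int m" for x
  proof -
    have "even x" using x by presburger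
    then obtain y where "x = 2 * y" by (elim evenE)
    then have "int m = 25 * y + 1" using x by simp
    then have "int m mod 25 = 1" by simp
    then have "int (m mod 25) = int 1" by (simp add: zmod_int)
    then show ?thesis by (simp only: of_nat_eq_iff)
  qed
  define a where "a = s div 5"
  have "s = 5 * a + s mod 5" "s mod 5 \<in> {0, 1, 2, 3, 4}" by (auto simp: a_def)
  then consider "s = 5 * a" | "s = 5 * a + 1" | "s = 5 * a + 2" | "s = 5 * a + 3" | "s = 5 * a + 4"
    by auto
  then show ?thesis
  proof cases
    case 1
    from s[unfolded 1] have "5 * (a * (15 * a + 1)) = 2 * int m" by (simp add: algebra_simps)
    from zero[OF this] show ?thesis by simp
  next
    case 2
    from s[unfolded 2] have "5 * (15 * (a * a) + 7 * a) + 4 = 2 * int m" by (simp add: algebra_simps)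
    from two[OF this] show ?thesis by simp
  next
    case 3
    from s[unfolded 3] have "5 * (15 * (a * a) + 13 * a + 2) + 4 = 2 * int m"
      by (simp add: algebra_simps)
    from two[OF this] show ?thesis by simp
  next
    case 4
    from s[unfolded 4] have "5 * (15 * (a * a) + 19 * a + 6) = 2 * int m" by (simp add: algebra_simps)
    from zero[OF this] show ?thesis by simp
  next
    case 5
    from s[unfolded 5] have "25 * (3 * (a * a) + 5 * a + 2) + 2 = 2 * int m"
      by (simp add: algebra_simps)
    from one[OF this] show ?thesis by (simp add: 5)
  qed
qed

lemma euler_nth_mod_5:
  assumes "fps_nth euler m \<noteq> 0"
  shows "m mod 5 = 0 \<or> m mod 25 = 1 \<or> m mod 5 = 2"
proof -
  obtain s :: int where s: "s * (3 * s + 1) = 2 * int m"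
    using assms unfolding euler_pentagonal by (auto elim!: sum.not_neutral_contains_not_neutral)
  then show ?thesis using pentagonal_mod_5 by blast
qed

text \<open>The map r -> -5r - 1 is a bijection from the solutions for \<open>m\<close> to those for
  \<open>25 * m + 1\<close>, and it changes parity, hence the sign.\<close>

lemma euler_nth_25: "fps_nth euler (25 * m + 1) = - fps_nth euler m"
proof -
  let ?S = "\<lambda>m. {s :: int. s * (3 * s + 1) = 2 * int m}"
  have inv: "\<exists>r. s = - 5 * r - 1" if "s \<in> ?S (25 * m + 1)" for s
  proof -
    have "(25 * m + 1) mod 5 = 1" by presburger
    with pentagonal_mod_5[of s "25 * m + 1"] that have "s mod 5 = 4" by simp
    then obtain a where "s = 5 * a + 4" by (metis mult_div_mod_eq)
    then show ?thesis by (intro exI[of _ "- a - 1"]) simp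
  qed
  have eq: "(- 5 * r - 1) * (3 * (- 5 * r - 1) + 1) = 25 * (r * (3 * r + 1)) + 2" for r :: int
    by (simp add: algebra_simps)
  have mem: "- 5 * r - 1 \<in> ?S (25 * m + 1) \<longleftrightarrow> r \<in> ?S m" for r
    unfolding mem_Collect_eq eq by auto
  have "?S (25 * m + 1) = (\<lambda>r. - 5 * r - 1) ` ?S m"
    using inv mem by blast
  moreover have "inj_on (\<lambda>r :: int. - 5 * r - 1) (?S m)" by (auto simp: inj_on_def)
  moreover have "(-1 :: int) ^ nat \<bar>- 5 * r - 1\<bar> = - ((-1) ^ nat \<bar>r\<bar>)" for r :: int
  proof -
    have "even (nat \<bar>- 5 * r - 1\<bar>) \<longleftrightarrow> odd (nat \<bar>r\<bar>)" by (simp add: even_nat_iff)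
    then show ?thesis by (cases "even (nat \<bar>r\<bar>)") simp_all
  qed
  ultimately show ?thesis
    unfolding euler_pentagonal by (simp add: sum.reindex sum_negf)
qed

text \<open>The product i(i+1) is 0, 1 or 2 modulo 5, whereas here 2m is 4, so the sum in Jacobi's
  identity is empty.\<close>

lemma euler_cubed_nth_mod_5:
  assumes "m mod 5 = 2"
  shows "fps_nth (euler ^ 3) m = 0"
proof -
  have False if i: "i * (i + 1) = 2 * m" for i
  proof -
    define a where "a = i div 5"
    have i_eq: "i = 5 * a + i mod 5" by (simp add: a_def)
    have "i mod 5 = 0 \<or> i mod 5 = 1 \<or> i mod 5 = 2 \<or> i mod 5 = 3 \<or> i mod 5 = 4"
      by presburger
    then have "i = 5 * a \<or> i = 5 * a + 1 \<or> i = 5 * a + 2 \<or> i = 5 * a + 3 \<or> i = 5 * a + 4"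
      using i_eq by (metis add_0_right)
    then have "\<exists>x. i * (i + 1) = 5 * x \<or> i * (i + 1) = 5 * x + 2 \<or> i * (i + 1) = 5 * x + 1"
    proof (elim disjE)
      assume "i = 5 * a"
      then show ?thesis by (intro exI[of _ "a * (5 * a + 1)"]) (simp add: algebra_simps)
    next
      assume "i = 5 * a + 1"
      then show ?thesis by (intro exI[of _ "5 * (a * a) + 3 * a"]) (simp add: algebra_simps)
    next
      assume "i = 5 * a + 2"
      then show ?thesis by (intro exI[of _ "5 * (a * a) + 5 * a + 1"]) (simp add: algebra_simps)
    next
      assume "i = 5 * a + 3"
      then show ?thesis by (intro exI[of _ "5 * (a * a) + 7 * a + 2"]) (simp add: algebra_simps)
    next
      assume "i = 5 * a + 4"
      then show ?thesis by (intro exI[of _ "5 * (a * a) + 9 * a + 4"]) (simp add: algebra_simps)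
    qed
    then have "2 * m mod 5 = 0 \<or> 2 * m mod 5 = 2 \<or> 2 * m mod 5 = 1"
      unfolding i by (elim exE disjE) (simp_all only: mod_mult_self4 mod_mult_self1_is_0, simp_all)
    moreover have "2 * m mod 5 = 2 * (m mod 5) mod 5" by (simp only: mod_mult_right_eq)
    ultimately show False by (simp add: assms)
  qed
  then have "{i. i * (i + 1) = 2 * m} = {}" by blast
  then show ?thesis unfolding euler_cubed by (simp only: sum.empty)
qed

lemma euler_residue_1: "residue_part 1 euler = - (fps_X * (euler oo fps_X ^ 25))"
proof (rule fps_ext)
  fix n :: nat
  show "fps_nth (residue_part 1 euler) n = fps_nth (- (fps_X * (euler oo fps_X ^ 25))) n"
  proof (cases "n mod 25 = 1")
    case True
    then obtain m where m: "n = 25 * m + 1" by (metis mult_div_mod_eq)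
    have "n mod 5 = 1" unfolding m by presburger
    then show ?thesis
      by (simp add: residue_part_nth m euler_nth_25[simplified] fps_nth_compose_X_power)
  next
    case False
    have "fps_nth euler n = 0" if "n mod 5 = 1"
      by (rule ccontr) (use euler_nth_mod_5[of n] False that in auto)
    then have "fps_nth (residue_part 1 euler) n = 0"
      by (simp add: residue_part_nth)
    moreover have "n = 0 \<or> \<not> 25 dvd (n - 1)" using False by presburger
    ultimately show ?thesis by (auto simp: fps_nth_compose_X_power)
  qed
qed

lemma euler_dissection:
  "euler = residue_part 0 euler + residue_part 1 euler + residue_part 2 euler"
proof (rule fps_ext)
  fix n :: nat
  have "n mod 25 mod 5 = n mod 5" by (rule mod_mod_cancel) simp
  then have "n mod 25 = 1 \<Longrightarrow> n mod 5 = 1" by simp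
  then show "fps_nth euler n =
      fps_nth (residue_part 0 euler + residue_part 1 euler + residue_part 2 euler) n"
    using euler_nth_mod_5[of n] by (cases "fps_nth euler n = 0") (auto simp: residue_part_nth)
qed

text \<open>Permits cancelling A, whose constant term is 1.\<close>

lemma residue_part_0_euler_nonzero: "residue_part 0 euler \<noteq> 0"
proof
  assume "residue_part 0 euler = 0"
  then have "fps_nth (residue_part 0 euler) 0 = 0" by simp
  then show False by (simp add: residue_part_nth)
qed

text \<open>
  By Jacobi's identity $E^3$ has no exponents congruent to 2 modulo 5, and in the expansion of
  $(A + B + C)^3$ that part is $3 A (A C + B^2)$.
\<close>
lemma euler_dissection_product:
  "residue_part 0 euler * residue_part 2 euler = - (residue_part 1 euler)\<^sup>2"
proof -
  define A B C where "A = residue_part 0 euler" "B = residue_part 1 euler" "C = residue_part 2 euler"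
  have A: "on_residue 0 A" and B: "on_residue 1 B" and C: "on_residue 2 C"
    unfolding A_B_C_def by (rule on_residue_part)+
  have part: "residue_part 2 (A ^ i * (B ^ j * C ^ l)) =
      (if 2 = (j + 2 * l) mod 5 then A ^ i * (B ^ j * C ^ l) else 0)" for i j l
    using residue_part_on_residue[OF on_residue_mult[OF on_residue_power[OF A, of i]
          on_residue_mult[OF on_residue_power[OF B, of j] on_residue_power[OF C, of l]]], of 2]
    by (simp add: mult.commute)
  have "euler ^ 3 = (A + B + C) ^ 3"
    unfolding A_B_C_def using euler_dissection by simp
  also have "\<dots> = A ^ 3 * (B ^ 0 * C ^ 0) + 3 * (A ^ 2 * (B ^ 1 * C ^ 0)) +
      3 * (A ^ 2 * (B ^ 0 * C ^ 1)) + 3 * (A ^ 1 * (B ^ 2 * C ^ 0)) + 6 * (A ^ 1 * (B ^ 1 * C ^ 1)) +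
      3 * (A ^ 1 * (B ^ 0 * C ^ 2)) + A ^ 0 * (B ^ 3 * C ^ 0) + 3 * (A ^ 0 * (B ^ 2 * C ^ 1)) +
      3 * (A ^ 0 * (B ^ 1 * C ^ 2)) + A ^ 0 * (B ^ 0 * C ^ 3)"
    by (simp add: power3_eq_cube power2_eq_square algebra_simps)
  finally have "residue_part 2 (euler ^ 3) = residue_part 2 \<dots>" by (rule arg_cong)
  also have "\<dots> = 3 * (A * (A * C + B\<^sup>2))"
    unfolding residue_part_add residue_part_numeral_mult part
    by (simp add: power2_eq_square algebra_simps)
  also have "residue_part 2 (euler ^ 3) = 0"
    using euler_cubed_nth_mod_5 by (auto simp: fps_eq_iff residue_part_nth)
  finally have *: "3 * (A * (A * C + B\<^sup>2)) = 0" by simp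
  have "A * (A * C + B\<^sup>2) = 0"
  proof (rule fps_ext)
    fix n
    have "fps_nth (3 * (A * (A * C + B\<^sup>2))) n = 0" unfolding * by simp
    then show "fps_nth (A * (A * C + B\<^sup>2)) n = fps_nth 0 n" by (simp add: numeral_fps_const)
  qed
  then have "A * C + B\<^sup>2 = 0"
    using residue_part_0_euler_nonzero by (simp add: A_B_C_def)
  then show ?thesis unfolding A_B_C_def by (simp add: eq_neg_iff_add_eq_0)
qed

section \<open>Powers of A^2 + A B - B^2 and of E by residue class modulo 5\<close>

lemma trinomial_power_2:
  fixes a b :: "'a :: idom"
  shows "(a\<^sup>2 + a * b - b\<^sup>2) ^ 2 =
     a ^ 4 + 2 * (a ^ 3 * b) - a ^ 2 * b ^ 2 - 2 * (a * b ^ 3) + b ^ 4"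
  by algebra

lemma trinomial_power_4:
  fixes a b :: "'a :: idom"
  shows "(a\<^sup>2 + a * b - b\<^sup>2) ^ 4 =
     a ^ 8 + 4 * (a ^ 7 * b) + 2 * (a ^ 6 * b ^ 2) - 8 * (a ^ 5 * b ^ 3) - 5 * (a ^ 4 * b ^ 4)
     + 8 * (a ^ 3 * b ^ 5) + 2 * (a ^ 2 * b ^ 6) - 4 * (a * b ^ 7) + b ^ 8"
proof -
  have split: "(a\<^sup>2 + a * b - b\<^sup>2) ^ 4 = (a\<^sup>2 + a * b - b\<^sup>2) ^ 2 * (a\<^sup>2 + a * b - b\<^sup>2) ^ 2"
    by (simp flip: power_add)
  show ?thesis
    unfolding split trinomial_power_2 by algebra
qed

lemma trinomial_power_6:
  fixes a b :: "'a :: idom"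
  shows "(a\<^sup>2 + a * b - b\<^sup>2) ^ 6 =
     a ^ 12 + 6 * (a ^ 11 * b) + 9 * (a ^ 10 * b ^ 2) - 10 * (a ^ 9 * b ^ 3) - 30 * (a ^ 8 * b
     ^ 4) + 6 * (a ^ 7 * b ^ 5) + 41 * (a ^ 6 * b ^ 6) - 6 * (a ^ 5 * b ^ 7) - 30 * (a ^ 4 * b
     ^ 8) + 10 * (a ^ 3 * b ^ 9) + 9 * (a ^ 2 * b ^ 10) - 6 * (a * b ^ 11) + b ^ 12"
proof -
  have split: "(a\<^sup>2 + a * b - b\<^sup>2) ^ 6 = (a\<^sup>2 + a * b - b\<^sup>2) ^ 2 * (a\<^sup>2 + a * b - b\<^sup>2) ^ 4"
    by (simp flip: power_add)
  show ?thesis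
    unfolding split trinomial_power_2 trinomial_power_4 by algebra
qed

text \<open>The terms with b^3 and b^13 cancel, so b^8 is the only power of \<open>b\<close> with
  exponent 3 modulo 5; its coefficient is -5^3.\<close>

lemma trinomial_power_8:
  fixes a b :: "'a :: idom"
  shows "(a\<^sup>2 + a * b - b\<^sup>2) ^ 8 =
     a ^ 16 + 8 * (a ^ 15 * b) + 20 * (a ^ 14 * b ^ 2) - 70 * (a ^ 12 * b ^ 4) - 56 * (a ^ 11 *
     b ^ 5) + 112 * (a ^ 10 * b ^ 6) + 120 * (a ^ 9 * b ^ 7) - 125 * (a ^ 8 * b ^ 8) - 120 * (a
     ^ 7 * b ^ 9) + 112 * (a ^ 6 * b ^ 10) + 56 * (a ^ 5 * b ^ 11) - 70 * (a ^ 4 * b ^ 12) + 20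
     * (a ^ 2 * b ^ 14) - 8 * (a * b ^ 15) + b ^ 16"
proof -
  have split: "(a\<^sup>2 + a * b - b\<^sup>2) ^ 8 = (a\<^sup>2 + a * b - b\<^sup>2) ^ 4 * (a\<^sup>2 + a * b - b\<^sup>2) ^ 4"
    by (simp flip: power_add)
  show ?thesis
    unfolding split trinomial_power_4 by algebra
qed

text \<open>The terms with b^4, b^9, b^19 and b^24 cancel, so b^14 is the only power of
  \<open>b\<close> with exponent 4 modulo 5; its coefficient is -5^6.\<close>

lemma trinomial_power_14:
  fixes a b :: "'a :: idom"
  shows "(a\<^sup>2 + a * b - b\<^sup>2) ^ 14 =
     a ^ 28 + 14 * (a ^ 27 * b) + 77 * (a ^ 26 * b ^ 2) + 182 * (a ^ 25 * b ^ 3) - 910 * (a ^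
     23 * b ^ 5) - 1365 * (a ^ 22 * b ^ 6) + 1430 * (a ^ 21 * b ^ 7) + 5005 * (a ^ 20 * b ^ 8)
     - 10010 * (a ^ 18 * b ^ 10) - 3640 * (a ^ 17 * b ^ 11) + 14105 * (a ^ 16 * b ^ 12) + 6930
     * (a ^ 15 * b ^ 13) - 15625 * (a ^ 14 * b ^ 14) - 6930 * (a ^ 13 * b ^ 15) + 14105 * (a ^
     12 * b ^ 16) + 3640 * (a ^ 11 * b ^ 17) - 10010 * (a ^ 10 * b ^ 18) + 5005 * (a ^ 8 * b ^
     20) - 1430 * (a ^ 7 * b ^ 21) - 1365 * (a ^ 6 * b ^ 22) + 910 * (a ^ 5 * b ^ 23) - 182 *
     (a ^ 3 * b ^ 25) + 77 * (a ^ 2 * b ^ 26) - 14 * (a * b ^ 27) + b ^ 28"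
proof -
  have split: "(a\<^sup>2 + a * b - b\<^sup>2) ^ 14 = (a\<^sup>2 + a * b - b\<^sup>2) ^ 6 * (a\<^sup>2 + a * b - b\<^sup>2) ^ 8"
    by (simp flip: power_add)
  show ?thesis
    unfolding split trinomial_power_6 trinomial_power_8 by algebra
qed

text \<open>From A C = -B^2 follows A E = A^2 + A B - B^2. The factor A^d has exponents divisible by
  5 only, so it passes through the extraction of a residue class and cancels.\<close>

lemma euler_power_dissection:
  fixes c :: "int fps"
  assumes "residue_part r (((residue_part 0 euler)\<^sup>2 + residue_part 0 euler * residue_part 1 euler -
      (residue_part 1 euler)\<^sup>2) ^ d) = c * (residue_part 0 euler ^ d * residue_part 1 euler ^ d)"
  shows "residue_part r (euler ^ d) = c * residue_part 1 euler ^ d"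
proof -
  define A B C where "A = residue_part 0 euler" "B = residue_part 1 euler" "C = residue_part 2 euler"
  have "A * euler = A\<^sup>2 + A * B - B\<^sup>2"
    unfolding A_B_C_def by (subst (2) euler_dissection)
      (simp add: distrib_left euler_dissection_product power2_eq_square)
  then have "A ^ d * euler ^ d = (A\<^sup>2 + A * B - B\<^sup>2) ^ d"
    by (metis power_mult_distrib)
  then have "residue_part r (A ^ d * euler ^ d) = c * (A ^ d * B ^ d)"
    using assms by (simp add: A_B_C_def)
  moreover have "residue_part r (A ^ d * euler ^ d) = A ^ d * residue_part r (euler ^ d)"
    using on_residue_power[OF on_residue_part[of 0 euler], of d]
    by (intro residue_part_mult) (simp add: A_B_C_def)
  ultimately have "A ^ d * residue_part r (euler ^ d) = A ^ d * (c * B ^ d)"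
    by (simp add: mult_ac)
  then show ?thesis using residue_part_0_euler_nonzero by (simp add: A_B_C_def)
qed

lemma residue_part_monomial:
  "residue_part r (residue_part 0 euler ^ i * residue_part 1 euler ^ j) =
     (if r mod 5 = j mod 5 then residue_part 0 euler ^ i * residue_part 1 euler ^ j else 0)"
  using residue_part_on_residue[OF on_residue_mult[OF on_residue_power[OF on_residue_part[of 0 euler], of i]
        on_residue_power[OF on_residue_part[of 1 euler], of j]], of r]
  by simp

text \<open>The expansions contain monomials in which an exponent 0 or 1 is not written as a power;
  these instances match them.\<close>

lemmas residue_part_monomials = residue_part_monomial
  residue_part_monomial[of _ _ 0, unfolded power_0 mult_1_right]
  residue_part_monomial[of _ 0, unfolded power_0 mult_1_left]
  residue_part_monomial[of _ _ 1, unfolded power_one_right]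
  residue_part_monomial[of _ 1, unfolded power_one_right]

lemma residue_part_3_euler_power_8: "residue_part 3 (euler ^ 8) = - 125 * residue_part 1 euler ^ 8"
  by (rule euler_power_dissection, unfold trinomial_power_8 residue_part_add residue_part_diff
      residue_part_numeral_mult residue_part_monomials) simp

lemma residue_part_4_euler_power_14: "residue_part 4 (euler ^ 14) = - 15625 * residue_part 1 euler ^ 14"
  by (rule euler_power_dissection, unfold trinomial_power_14 residue_part_add residue_part_diff
      residue_part_numeral_mult residue_part_monomials) simp

text \<open>For even \<open>d\<close> the sign in B = -q E(q^25) disappears, so B^d = q^d
  E(q^25)^d.\<close>

lemma residue_part_1_euler_power_nth:
  assumes "even d"
  shows "fps_nth (residue_part 1 euler ^ d) n =
    (if d \<le> n \<and> 25 dvd n - d then fps_nth (euler ^ d) ((n - d) div 25) else 0)"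
proof -
  have "residue_part 1 euler ^ d = fps_X ^ d * ((euler ^ d) oo fps_X ^ 25)"
    unfolding euler_residue_1 using assms by (simp add: power_mult_distrib fps_compose_power)
  then show ?thesis by (auto simp: fps_X_power_mult_nth fps_nth_compose_X_power)
qed

section \<open>Divisibility of coefficients\<close>

text \<open>Descent by two powers of 5. The coefficient at N = 25n + d is \<open>c\<close> times the
  one at n, and the condition on \<open>a\<close>, \<open>d\<close>, \<open>e\<close> says that the
  linear form at N is 25 times the form at n.\<close>

lemma euler_power_dvd_of_residue_part:
  fixes a e :: int
  assumes d: "even d" "a * int d + e = 25 * e"
    and c: "25 dvd c" "residue_part r (euler ^ d) = fps_const c * residue_part 1 euler ^ d"
    and r: "\<And>N. 5 dvd a * int N + e \<Longrightarrow> N mod 5 = r mod 5"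
  shows "5 ^ j dvd a * int N + e \<Longrightarrow> 5 ^ j dvd fps_nth (euler ^ d) N"
proof (induction j arbitrary: N rule: less_induct)
  case (less j)
  show ?case
  proof (cases "j = 0")
    case False
    then have "5 dvd a * int N + e"
      using less.prems by (meson dvd_power dvd_trans neq0_conv)
    then have "fps_nth (euler ^ d) N = fps_nth (residue_part r (euler ^ d)) N"
      by (simp add: residue_part_nth r)
    also have "\<dots> = c * fps_nth (residue_part 1 euler ^ d) N"
      unfolding c by simp
    also have "5 ^ j dvd \<dots>"
    proof (cases "d \<le> N \<and> 25 dvd N - d")
      case True
      then obtain n where n: "N = 25 * n + d" by (metis dvdE le_add_diff_inverse2)
      have nth: "fps_nth (residue_part 1 euler ^ d) N = fps_nth (euler ^ d) n"
        unfolding residue_part_1_euler_power_nth[OF d(1)] by (simp add: n)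
      have "a * int N + e = 25 * (a * int n + e)"
        using d(2) by (simp add: n algebra_simps)
      with less.prems have *: "5 ^ j dvd 25 * (a * int n + e)" by simp
      \<comment> \<open>For \<open>j = 1\<close> the descent would overshoot, but the divisibility
        of \<open>c\<close> by 25 is already enough.\<close>
      consider "j = 1" | i where "j = i + 2"
        using False by (metis One_nat_def add_2_eq_Suc' not0_implies_Suc)
      then show ?thesis
      proof cases
        case 1
        with c(1) show ?thesis by (auto elim!: dvdE)
      next
        case 2
        then have pow: "(5 :: int) ^ j = 25 * 5 ^ i" by (simp add: power_add)
        from * have "5 ^ i dvd a * int n + e"
          unfolding pow by (simp only: dvd_mult_cancel_left) simp
        then have "5 ^ i dvd fps_nth (euler ^ d) n" by (intro less.IH) (simp_all add: 2)
        with c(1) have "25 * 5 ^ i dvd c * fps_nth (euler ^ d) n" by (rule mult_dvd_mono)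
        then show ?thesis unfolding nth pow .
      qed
    next
      case False
      then show ?thesis by (simp only: residue_part_1_euler_power_nth[OF d(1)] if_False) simp
    qed
    finally show ?thesis .
  qed simp
qed

text \<open>The form 3N + 1 is (24N + 8)/8, and 3 * 8 + 1 = 25.\<close>

lemma euler_power_8_dvd: "5 ^ j dvd 3 * int N + 1 \<Longrightarrow> 5 ^ j dvd fps_nth (euler ^ 8) N"
proof (rule euler_power_dvd_of_residue_part[where c = "- 125" and r = 3])
  show "residue_part 3 (euler ^ 8) = fps_const (- 125) * residue_part 1 euler ^ 8"
    unfolding residue_part_3_euler_power_8 by (simp add: numeral_fps_const)
  show "N mod 5 = 3 mod 5" if "5 dvd 3 * int N + 1" for N
    using that by presburger
qed auto

text \<open>The form 12N + 7 is (24N + 14)/2, and 12 * 14 + 7 = 25 * 7.\<close>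

lemma euler_power_14_dvd: "5 ^ j dvd 12 * int N + 7 \<Longrightarrow> 5 ^ j dvd fps_nth (euler ^ 14) N"
proof (rule euler_power_dvd_of_residue_part[where c = "- 15625" and r = 4])
  show "residue_part 4 (euler ^ 14) = fps_const (- 15625) * residue_part 1 euler ^ 14"
    unfolding residue_part_4_euler_power_14 by (simp add: numeral_fps_const)
  show "N mod 5 = 4 mod 5" if "5 dvd 12 * int N + 7" for N
    using that by presburger
qed auto

text \<open>Descent: once \<open>l\<close> divides both \<open>u\<close> and \<open>v\<close>,
  dividing them by \<open>l\<close> removes l^2 from the sum of squares and from the product
  alike.\<close>

lemma power_dvd_mult_of_sum_squares:
  fixes l u v :: int
  assumes l: "\<And>u v :: int. l dvd u\<^sup>2 + v\<^sup>2 \<Longrightarrow> l dvd u \<and> l dvd v" and "l \<noteq> 0"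
  shows "l ^ j dvd u\<^sup>2 + v\<^sup>2 \<Longrightarrow> l ^ j dvd u * v"
proof (induction j arbitrary: u v rule: less_induct)
  case (less j)
  show ?case
  proof (cases "j = 0")
    case False
    then have "l dvd u\<^sup>2 + v\<^sup>2"
      using less.prems by (meson dvd_power dvd_trans neq0_conv)
    then obtain x y where xy: "u = l * x" "v = l * y"
      using l by (meson dvdE)
    consider "j = 1" | i where "j = i + 2"
      using False by (metis One_nat_def add_2_eq_Suc' not0_implies_Suc)
    then show ?thesis
    proof cases
      case 2
      have "l\<^sup>2 * l ^ i dvd l\<^sup>2 * (x\<^sup>2 + y\<^sup>2)"
        using less.prems by (simp add: xy 2 power_add algebra_simps power2_eq_square)
      then have "l ^ i dvd x\<^sup>2 + y\<^sup>2" using \<open>l \<noteq> 0\<close> by simp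
      then have "l ^ i dvd x * y" by (intro less.IH) (simp_all add: 2)
      then have "l\<^sup>2 * l ^ i dvd l\<^sup>2 * (x * y)" by (rule mult_dvd_mono[OF dvd_refl])
      then show ?thesis by (simp add: xy 2 power_add power2_eq_square mult_ac)
    qed (simp add: xy)
  qed simp
qed

text \<open>The sum in Jacobi's identity has at most one term, as i(i+1) is strictly increasing; x =
  2i + 1 is its coefficient up to sign.\<close>

lemma euler_cubed_nth_nonzero:
  assumes "fps_nth (euler ^ 3) m \<noteq> 0"
  obtains x where "x\<^sup>2 = 8 * int m + 1" "x dvd fps_nth (euler ^ 3) m"
proof -
  let ?S = "{i. i * (i + 1) = 2 * m}"
  obtain i where i: "i * (i + 1) = 2 * m"
    using assms unfolding euler_cubed by (auto elim!: sum.not_neutral_contains_not_neutral)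
  have "j = i" if "j * (j + 1) = 2 * m" for j
  proof (rule linorder_cases[of i j])
    assume "i < j"
    then have "i * (i + 1) < j * (j + 1)" by (intro mult_strict_mono) auto
    with i that show ?thesis by simp
  next
    assume "j < i"
    then have "j * (j + 1) < i * (i + 1)" by (intro mult_strict_mono) auto
    with i that show ?thesis by simp
  qed simp
  with i have S: "?S = {i}" by blast
  have "int i * (int i + 1) = 2 * int m"
    using arg_cong[OF i, of int] by (simp only: of_nat_mult of_nat_add of_nat_1 of_nat_numeral)
  then have "(2 * int i + 1)\<^sup>2 = 8 * int m + 1"
    by (simp add: power2_eq_square algebra_simps)
  moreover have "2 * int i + 1 dvd fps_nth (euler ^ 3) m"
    unfolding euler_cubed S by simp
  ultimately show thesis using that by blast
qed

lemma euler_power_6_dvd: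
  fixes l :: int
  assumes l: "\<And>u v :: int. l dvd u\<^sup>2 + v\<^sup>2 \<Longrightarrow> l dvd u \<and> l dvd v" "l \<noteq> 0"
    and dvd: "l ^ j dvd 4 * int N + 1"
  shows "l ^ j dvd fps_nth (euler ^ 6) N"
proof -
  have "euler ^ 6 = euler ^ 3 * euler ^ 3" by (simp flip: power_add)
  then have "fps_nth (euler ^ 6) N = (\<Sum>i=0..N. fps_nth (euler ^ 3) i * fps_nth (euler ^ 3) (N - i))"
    by (simp only: fps_mult_nth)
  also have "l ^ j dvd \<dots>"
  proof (rule dvd_sum)
    fix i assume i: "i \<in> {0..N}"
    show "l ^ j dvd fps_nth (euler ^ 3) i * fps_nth (euler ^ 3) (N - i)"
    proof (cases "fps_nth (euler ^ 3) i = 0 \<or> fps_nth (euler ^ 3) (N - i) = 0")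
      case False
      then obtain x y where x: "x\<^sup>2 = 8 * int i + 1" "x dvd fps_nth (euler ^ 3) i"
        and y: "y\<^sup>2 = 8 * int (N - i) + 1" "y dvd fps_nth (euler ^ 3) (N - i)"
        by (metis euler_cubed_nth_nonzero)
      have "x\<^sup>2 + y\<^sup>2 = 2 * (4 * int N + 1)"
        using i by (simp add: x(1) y(1) of_nat_diff)
      then have "l ^ j dvd x\<^sup>2 + y\<^sup>2" using dvd by (simp only: dvd_mult)
      then have "l ^ j dvd x * y" using power_dvd_mult_of_sum_squares[of l j x y] l by blast
      then show ?thesis using mult_dvd_mono[OF x(2) y(2)] by (rule dvd_trans)
    qed auto
  qed
  finally show ?thesis .
qed

text \<open>Compare coefficients in (f^n)' = n f' f^(n-1).\<close>

lemma fps_power_nth_dvd: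
  fixes f :: "int fps"
  shows "int n dvd int m * fps_nth (f ^ n) m"
proof (cases m)
  case (Suc i)
  have "fps_deriv (f ^ n) = fps_const (int n) * (fps_deriv f * f ^ (n - 1))"
    by (simp add: fps_deriv_power mult.assoc)
  then have "fps_nth (fps_deriv (f ^ n)) i = int n * fps_nth (fps_deriv f * f ^ (n - 1)) i"
    by simp
  then show ?thesis by (simp add: Suc)
qed simp

text \<open>
  The coefficient of $q^m$ in $E^{p^k r}$ is divisible by $p^{k - v(m)}$, where $v$ is the $p$-adic
  valuation, while $p^{v(m)}$ divides $a (N - m) + c$ and hence the complementary coefficient of $E^d$.
\<close>
lemma euler_power_add_dvd:
  fixes p :: nat
  assumes p: "prime p" and c: "\<And>j N. int p ^ j dvd a * int N + c \<Longrightarrow> int p ^ j dvd fps_nth (euler ^ d) N"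
    and N: "int p ^ k dvd a * int N + c"
  shows "int p ^ k dvd fps_nth (euler ^ (d + p ^ k * r)) N"
proof -
  let ?H = "euler ^ (p ^ k * r)"
  have "fps_nth (euler ^ (d + p ^ k * r)) N = (\<Sum>m=0..N. fps_nth ?H m * fps_nth (euler ^ d) (N - m))"
    by (simp add: power_add fps_mult_nth mult.commute[of "euler ^ d"])
  also have "int p ^ k dvd \<dots>"
  proof (rule dvd_sum)
    fix m assume "m \<in> {0..N}"
    then have m: "m \<le> N" by simp
    have c': "int p ^ j dvd fps_nth (euler ^ d) (N - m)" if "j \<le> k" "p ^ j dvd m" for j
    proof (rule c)
      have "int p ^ j dvd a * int m" using that(2) by (metis dvd_mult of_nat_dvd_iff of_nat_power)
      moreover have "int p ^ j dvd a * int N + c" using N that(1) by (metis power_le_dvd)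
      ultimately have "int p ^ j dvd (a * int N + c) - a * int m" by (rule dvd_diff[rotated])
      then show "int p ^ j dvd a * int (N - m) + c" using m by (simp add: of_nat_diff algebra_simps)
    qed
    show "int p ^ k dvd fps_nth ?H m * fps_nth (euler ^ d) (N - m)"
    \<comment> \<open>If p^k divides \<open>m\<close>, the factor from E^d supplies the whole power;
      otherwise the valuation \<open>j\<close> of \<open>m\<close> is less than \<open>k\<close> and
      the two factors supply p^(k-j) and p^j.\<close>
    proof (cases "p ^ k dvd m")
      case True
      then show ?thesis using c'[of k] by simp
    next
      case False
      then have "m \<noteq> 0" by (metis dvd_0_right)
      define j where "j = multiplicity p m"
      have j: "p ^ j dvd m" by (simp add: j_def multiplicity_dvd)
      have jk: "j < k" using False j by (metis le_imp_power_dvd dvd_trans not_less)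
      obtain u where u: "m = p ^ j * u" "\<not> p dvd u"
        unfolding j_def using \<open>m \<noteq> 0\<close> p by (elim multiplicity_decompose'[of m p]) auto
      have "int (p ^ k * r) dvd int m * fps_nth ?H m"
        by (rule fps_power_nth_dvd)
      then have "int p ^ k dvd int p ^ j * (int u * fps_nth ?H m)"
        by (metis dvd_mult_left mult.assoc of_nat_mult of_nat_power u(1))
      moreover have "int p ^ k = int p ^ j * int p ^ (k - j)"
        using jk by (simp flip: power_add)
      ultimately have "int p ^ (k - j) dvd int u * fps_nth ?H m"
        using prime_gt_0_nat[OF p] by simp
      moreover have "coprime (int p ^ (k - j)) (int u)"
        using p u(2) by (simp add: prime_imp_coprime)
      ultimately have "int p ^ (k - j) dvd fps_nth ?H m"
        by (simp add: coprime_dvd_mult_right_iff)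
      then have "int p ^ (k - j) * int p ^ j dvd fps_nth ?H m * fps_nth (euler ^ d) (N - m)"
        using c'[of j] jk j by (intro mult_dvd_mono) auto
      then show ?thesis using jk by (simp flip: power_add)
    qed
  qed
  finally show ?thesis .
qed

section \<open>From natural exponents to fractional ones\<close>

definition rat_fps :: "int fps \<Rightarrow> rat fps" where
  "rat_fps f = Abs_fps (\<lambda>n. of_int (fps_nth f n))"

lemma rat_fps_nth [simp]: "fps_nth (rat_fps f) n = of_int (fps_nth f n)"
  by (simp add: rat_fps_def)

lemma rat_fps_simps:
  "rat_fps 1 = 1" "rat_fps (f - g) = rat_fps f - rat_fps g" "rat_fps (f * g) = rat_fps f * rat_fps g"
  "rat_fps (fps_X ^ n) = fps_X ^ n"
  by (auto simp: fps_eq_iff fps_mult_nth fps_X_power_nth)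

lemma rat_fps_power: "rat_fps (f ^ n) = rat_fps f ^ n"
  by (induction n) (simp_all add: rat_fps_simps)

lemma p_frac_of_nat: "p_frac (of_nat T) n = of_int (fps_nth (euler ^ T) n)"
proof -
  \<comment> \<open>The index starts at 0, so the product has N + 1 factors, whence
    \<open>qpoch (Suc N)\<close>.\<close>
  have "(\<Prod>i\<le>N. one_minus_q_powr (Suc i) (of_nat T)) = rat_fps (qpoch (Suc N) ^ T)" for N
    by (induction N)
      (simp_all add: one_minus_q_powr_of_nat qpoch_Suc rat_fps_power rat_fps_simps power_mult_distrib
        rat_fps_simps(4)[of 1, simplified] del: power_Suc)
  then have "p_frac (of_nat T) n = of_int (fps_nth (qpoch (Suc n) ^ T) n)"
    by (simp add: p_frac_eq_finite_prod[OF order.refl])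
  also have "fps_nth (qpoch (Suc n) ^ T) n = fps_nth (euler ^ T) n"
    using agree_power[OF agree_euler_qpoch[of "Suc n"], of T] by (simp add: agree_def)
  finally show ?thesis .
qed

text \<open>The exponent t = d - p^k/b is approximated p-adically by a natural number T = d + p^k r,
  for which the coefficient is an integer covered by \<open>euler_power_add_dvd\<close>.\<close>

theorem p_frac_congruence:
  fixes p b :: nat
  assumes p: "prime p" and b: "b > 0" "coprime b p"
    and c: "\<And>j N. int p ^ j dvd a * int N + c \<Longrightarrow> int p ^ j dvd fps_nth (euler ^ d) N"
    and N: "int p ^ k dvd a * int N + c"
  shows "int p ^ k dvd fst (quotient_of (p_frac (- ((of_nat p ^ k - of_nat d * of_nat b) / of_nat b)) N))"
proof -
  define t :: rat where "t = - ((of_nat p ^ k - of_nat d * of_nat b) / of_nat b)"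
  have p': "prime (int p)" using p by simp
  obtain M where M: "\<And>y. padic_dvd (int p) M (y - t) \<Longrightarrow> padic_dvd (int p) k (p_frac y N - p_frac t N)"
    using padic_cont_p_frac[OF p', of t N] unfolding padic_cont_def by blast
  \<comment> \<open>The precision \<open>M\<close> is fixed by continuity first; then
    \<open>r\<close> is a nonnegative representative of -1/b modulo p^M. The choice works because T
    - t = p^k (r b + 1)/b.\<close>
  obtain r :: nat where r: "int p ^ M dvd int r * int b + 1"
  proof -
    have "coprime (int b) (int p ^ M)" using b(2) by simp
    then obtain u v where uv: "u * int b + v * int p ^ M = 1"
      using bezout_int[of "int b" "int p ^ M"] by auto
    have pos: "int p ^ M > 0" using prime_gt_0_nat[OF p] by simp
    have "(- u) mod int p ^ M * int b + 1 = int p ^ M * (v - (- u) div int p ^ M * int b)"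
      using uv by (simp add: minus_mult_div_eq_mod[symmetric] algebra_simps)
    then have "int p ^ M dvd (- u) mod int p ^ M * int b + 1" by (metis dvd_triv_left)
    then show thesis using pos by (intro that[of "nat ((- u) mod int p ^ M)"]) simp
  qed
  then obtain s where s: "int r * int b + 1 = int p ^ M * s" by blast
  define T where "T = d + p ^ k * r"
  have "of_int (int b) * (of_nat T - t) = of_int (int p ^ k * (int r * int b + 1))"
    using b(1) by (simp add: T_def t_def field_simps)
  also have "\<dots> = of_int (int p ^ M * (int p ^ k * s))" unfolding s by (simp add: mult_ac)
  finally have "padic_dvd (int p) M (of_nat T - t)"
    by (rule padic_dvdI[rotated]) (use b(2) in \<open>simp add: coprime_commute\<close>)
  then have "padic_dvd (int p) k (p_frac (of_nat T) N - p_frac t N)" by (rule M)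
  moreover have "padic_dvd (int p) k (p_frac (of_nat T) N)"
    unfolding p_frac_of_nat T_def using euler_power_add_dvd[OF p c N] by (intro padic_dvd_of_int)
  ultimately have "padic_dvd (int p) k (- (p_frac (of_nat T) N - p_frac t N) + p_frac (of_nat T) N)"
    by (intro padic_dvd_add padic_dvd_uminus)
  then show ?thesis unfolding t_def[symmetric] by (intro padic_dvd_imp_dvd_numerator) simp
qed

text \<open>-1 is not a square modulo 3, nor modulo 7 in the next lemma; both are verified by
  running through the residues.\<close>

lemma dvd_sum_squares_3:
  fixes u v :: int
  assumes "3 dvd u\<^sup>2 + v\<^sup>2"
  shows "3 dvd u \<and> 3 dvd v"
proof -
  have residues: "\<forall>x\<in>{0, 1, 2}. \<forall>y\<in>{0, 1, 2}.
      (x\<^sup>2 + y\<^sup>2) mod 3 = (0 :: int) \<longrightarrow> x = 0 \<and> y = 0"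
    by simp
  have "((u mod 3)\<^sup>2 + (v mod 3)\<^sup>2) mod 3 = (u\<^sup>2 + v\<^sup>2) mod 3"
    by (rule mod_add_cong) (rule power_mod)+
  also have "\<dots> = 0" using assms by simp
  finally have sum: "((u mod 3)\<^sup>2 + (v mod 3)\<^sup>2) mod 3 = 0" .
  have "u mod 3 \<in> {0, 1, 2}" "v mod 3 \<in> {0, 1, 2}" by auto
  from residues[rule_format, OF this sum] show ?thesis by (simp add: dvd_eq_mod_eq_0)
qed

lemma dvd_sum_squares_7:
  fixes u v :: int
  assumes "7 dvd u\<^sup>2 + v\<^sup>2"
  shows "7 dvd u \<and> 7 dvd v"
proof -
  have residues: "\<forall>x\<in>{0, 1, 2, 3, 4, 5, 6}. \<forall>y\<in>{0, 1, 2, 3, 4, 5, 6}.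
      (x\<^sup>2 + y\<^sup>2) mod 7 = (0 :: int) \<longrightarrow> x = 0 \<and> y = 0"
    by simp
  have "((u mod 7)\<^sup>2 + (v mod 7)\<^sup>2) mod 7 = (u\<^sup>2 + v\<^sup>2) mod 7"
    by (rule mod_add_cong) (rule power_mod)+
  also have "\<dots> = 0" using assms by simp
  finally have sum: "((u mod 7)\<^sup>2 + (v mod 7)\<^sup>2) mod 7 = 0" .
  have "u mod 7 \<in> {0, 1, 2, 3, 4, 5, 6}" "v mod 7 \<in> {0, 1, 2, 3, 4, 5, 6}" by auto
  from residues[rule_format, OF this sum] show ?thesis by (simp add: dvd_eq_mod_eq_0)
qed

theorem theorem1p10:
  fixes k :: nat
  assumes "k > 1" and "odd k"
  shows "(\<forall>n b :: nat. b > 0 \<and> coprime b 3 \<longrightarrow>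
      (3 :: int) ^ k dvd fst (quotient_of
        (p_frac (- ((3 ^ k - 6 * of_nat b) / of_nat b)) (3 ^ k * n + (3 ^ (k + 1) - 1) div 4)))) \<and>
    (\<forall>n b :: nat. b > 0 \<and> coprime b 5 \<longrightarrow>
      (5 :: int) ^ k dvd fst (quotient_of
        (p_frac (- ((5 ^ k - 8 * of_nat b) / of_nat b)) (5 ^ k * n + (2 * 5 ^ k - 1) div 3)))) \<and>
    (\<forall>n b :: nat. b > 0 \<and> coprime b 5 \<longrightarrow>
      (5 :: int) ^ k dvd fst (quotient_of
        (p_frac (- ((5 ^ k - 14 * of_nat b) / of_nat b)) (5 ^ k * n + (11 * 5 ^ k - 7) div 12)))) \<and>
    (\<forall>n b :: nat. b > 0 \<and> coprime b 7 \<longrightarrow>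
      (7 :: int) ^ k dvd fst (quotient_of
        (p_frac (- ((7 ^ k - 6 * of_nat b) / of_nat b)) (7 ^ k * n + (3 * 7 ^ k - 1) div 4))))"
proof (intro conjI allI impI)
  fix n b :: nat
  \<comment> \<open>Each index in the theorem has the shape N = p^k n + (m - f)/e with p^k dividing
    \<open>m\<close>. Exactness of the division, which comes from odd \<open>k\<close>, gives e N +
    f = p^k e n + m.\<close>
  have index: "int p ^ k dvd int e * int (p ^ k * n + (m - f) div e) + int f"
    if "e dvd m - f" "f \<le> m" "p ^ k dvd m" for p e m f :: nat
  proof -
    have "e * (p ^ k * n + (m - f) div e) + f = p ^ k * (e * n) + m"
      using that(1,2) by (simp add: algebra_simps)
    moreover have "p ^ k dvd p ^ k * (e * n) + m" using that(3) by simp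
    ultimately have "int (p ^ k) dvd int (e * (p ^ k * n + (m - f) div e) + f)"
      by (simp only: of_nat_dvd_iff)
    then show ?thesis by simp
  qed
  note exact = index_divisions_exact[OF assms(2)]
  \<comment> \<open>Ensures that the natural-number subtraction of 7 in the third index is not
    truncated.\<close>
  have le: "7 \<le> 11 * (5 :: nat) ^ k"
    using one_le_power[of "5 :: nat" k] by linarith
  {
    assume "b > 0 \<and> coprime b 3"
    then show "(3 :: int) ^ k dvd fst (quotient_of
        (p_frac (- ((3 ^ k - 6 * of_nat b) / of_nat b)) (3 ^ k * n + (3 ^ (k + 1) - 1) div 4)))"
      using p_frac_congruence[of 3 b 4 1 6 k "3 ^ k * n + (3 ^ (k + 1) - 1) div 4"]
        index[OF exact(1), of 3] euler_power_6_dvd[OF dvd_sum_squares_3]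
      by simp
  next
    assume "b > 0 \<and> coprime b 5"
    then show "(5 :: int) ^ k dvd fst (quotient_of
        (p_frac (- ((5 ^ k - 8 * of_nat b) / of_nat b)) (5 ^ k * n + (2 * 5 ^ k - 1) div 3)))"
      using p_frac_congruence[of 5 b 3 1 8 k "5 ^ k * n + (2 * 5 ^ k - 1) div 3"]
        index[OF exact(2), of 5] euler_power_8_dvd
      by simp
  next
    assume "b > 0 \<and> coprime b 5"
    then show "(5 :: int) ^ k dvd fst (quotient_of
        (p_frac (- ((5 ^ k - 14 * of_nat b) / of_nat b)) (5 ^ k * n + (11 * 5 ^ k - 7) div 12)))"
      using p_frac_congruence[of 5 b 12 7 14 k "5 ^ k * n + (11 * 5 ^ k - 7) div 12"]
        index[OF exact(3) le, of 5] euler_power_14_dvd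
      by simp
  next
    assume "b > 0 \<and> coprime b 7"
    then show "(7 :: int) ^ k dvd fst (quotient_of
        (p_frac (- ((7 ^ k - 6 * of_nat b) / of_nat b)) (7 ^ k * n + (3 * 7 ^ k - 1) div 4)))"
      using p_frac_congruence[of 7 b 4 1 6 k "7 ^ k * n + (3 * 7 ^ k - 1) div 4"]
        index[OF exact(4), of 7] euler_power_6_dvd[OF dvd_sum_squares_7]
      by simp
  }
qed

end
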